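(* Let $\mathcal{F} \subseteq 2^{[n]}$ be an intersecting $B$-free family with $2 \le |F| \le n-2$ for all $F \in \mathcal{F}$. Then \[ \sum_{F\in\mathcal{F},\ |F|\le n/2}\frac{1}{\binom{n}{|F|-1}}+\sum_{F\in\mathcal{F},\ |F|>n/2}\frac{1}{\binom{n}{|F|}}\le 2. \]
   Context: $[n]=\{1,\dots,n\}$. A family is intersecting if any two of its members have nonempty intersection. The butterfly poset $B$ has four elements $w,x,y,z$ with relations $w,x\le y,z$. A family $\mathcal{F}$ is $B$-free if there are no four distinct sets $A_1,A_2,A_3,A_4\in\mathcal{F}$ with $A_1,A_2\subseteq A_3$ and $A_1,A_2\subseteq A_4$. *)

theory Defs
  imports Complex_Main
begin

text \<open>Two members may coincide here, so an intersecting family contains no empty set.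
  For families of nonempty sets this agrees with requiring the condition for distinct
  members only.\<close>

definition intersecting :: "'a set set \<Rightarrow> bool" where
  "intersecting \<F> \<longleftrightarrow> (\<forall>A\<in>\<F>. \<forall>B\<in>\<F>. A \<inter> B \<noteq> {})"

text \<open>The copy of the butterfly need not be induced: further inclusions among the
  four sets are allowed, so a chain of four sets is also excluded.\<close>

definition butterfly_free :: "'a set set \<Rightarrow> bool" where
  "butterfly_free \<F> \<longleftrightarrow>
    \<not> (\<exists>A\<^sub>1\<in>\<F>. \<exists>A\<^sub>2\<in>\<F>. \<exists>A\<^sub>3\<in>\<F>. \<exists>A\<^sub>4\<in>\<F>.
        distinct [A\<^sub>1, A\<^sub>2, A\<^sub>3, A\<^sub>4] \<and>
        A\<^sub>1 \<subseteq> A\<^sub>3 \<and> A\<^sub>2 \<subseteq> A\<^sub>3 \<and> A\<^sub>1 \<subseteq> A\<^sub>4 \<and> A\<^sub>2 \<subseteq> A\<^sub>4)"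

end

theory Submission
  imports Defs "HOL-Combinatorics.Permutations"
begin

text \<open>The proof averages over all cyclic orders of the ground set. On a single cycle, an intersecting
  antichain of arcs satisfies the Greene--Katona--Kleitman inequality. A butterfly-free family splits into its minimal
  sets, its remaining maximal sets, and an antichain of middle sets \<open>F\<close>, each lying between a unique
  lower set \<open>A\<close> and a unique upper set \<open>C\<close>. If \<open>A\<close> is not an arc, then \<open>F\<close> can join the antichain of minimal
  arcs; if \<open>C\<close> is not an arc, it can join the antichain of maximal ones. So \<open>F\<close> is counted
  zero, one or two times. Given that \<open>F\<close> is an arc with \<open>b\<close> elements, \<open>A\<close> is an arc with probability at most \<open>2 / b\<close>, and
  \<open>C\<close>, independently, with probability at most \<open>2 / (n - b)\<close>; this uses that all sizes are between 2 and \<open>n - 2\<close>.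
  If \<open>2 / b + 2 / (n - b) \<le> 1\<close>, then \<open>F\<close> is counted at least once on average. The only exceptions are \<open>n \<in> {6, 7, 8}\<close> with
  \<open>b \<in> {3, n - 3}\<close>. There, the inequality on the cycle has enough slack to count a fraction of \<open>F\<close> also
  when both \<open>A\<close> and \<open>C\<close> are arcs.\<close>

section \<open>Intersecting antichains of arcs\<close>

text \<open>The weight is dictated by the goal: \<open>wt n k / (n choose k)\<close> is
  \<open>1 / (n choose (k - 1))\<close> if \<open>2 * k \<le> n\<close>, and
  \<open>1 / (n choose k)\<close> otherwise. A member F is the image of the arc with a given start
  and length |F| for n! / (n choose |F|) permutations, so a bound 2n on every cycle becomes 2 after
  division by the n starts and n! permutations. Independence holds because, once F occupies an arc,
  A depends only on the order inside F and C only on the order outside. The obstacle is a middle set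
  with both A and C arcs: it fits into neither antichain, yet dropping it can spoil the average. Its
  share is paid from two sources. A middle arc of length 3 lies above an arc of length 2, which
  costs the lower antichain a whole unit; and every middle arc restricts the arcs of the upper
  antichain that begin or end at its end points.\<close>

definition wt :: "int \<Rightarrow> int \<Rightarrow> real" where
  "wt N k = (if 2 * k \<le> N then of_int (N - k + 1) / of_int k else 1)"

definition tot :: "int \<Rightarrow> (int \<Rightarrow> real) \<Rightarrow> (int \<Rightarrow> int \<Rightarrow> bool) \<Rightarrow> real" where
  "tot N g P = (\<Sum>s\<in>{0..<N}. \<Sum>k\<in>{2..N-2}. if P s k then g k else 0)"

lemma wt_antimono:
  assumes "0 < r" "r \<le> k"
  shows "wt N k \<le> wt N r"
proof (cases "2 * k \<le> N")
  case True
  have "wt N k = (of_int N + 1) / of_int k - 1" "wt N r = (of_int N + 1) / of_int r - 1"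
    using assms True by (auto simp: wt_def field_simps)
  moreover have "(of_int N + 1) / of_int k \<le> (of_int N + 1) / (of_int r :: real)"
    using assms True by (intro divide_left_mono) auto
  ultimately show ?thesis by linarith
next
  case False
  then show ?thesis using assms by (simp add: wt_def le_divide_eq)
qed

lemma sum_at_most_one:
  fixes g :: "'a \<Rightarrow> real"
  assumes "finite K" "\<And>k l. k \<in> K \<Longrightarrow> l \<in> K \<Longrightarrow> Q k \<Longrightarrow> Q l \<Longrightarrow> k = l"
  shows "(\<forall>k\<in>K. \<not> Q k) \<and> (\<Sum>k\<in>K. if Q k then g k else 0) = 0
    \<or> (\<exists>k\<in>K. Q k \<and> (\<Sum>k\<in>K. if Q k then g k else 0) = g k)"
proof (cases "\<exists>k\<in>K. Q k")
  case True
  then obtain k where k: "k \<in> K" "Q k" by blast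
  have "(\<Sum>l\<in>K. if Q l then g l else 0) = (\<Sum>l\<in>K. if l = k then g k else 0)"
    by (rule sum.cong) (use assms k in auto)
  also have "\<dots> = g k" using assms(1) k by simp
  finally show ?thesis using k by blast
next
  case False
  then have "(\<Sum>l\<in>K. if Q l then g l else 0) = 0" by (intro sum.neutral) auto
  with False show ?thesis by blast
qed

lemma sum_at_most_one_le:
  fixes g :: "'a \<Rightarrow> real"
  assumes "finite K" "\<And>k l. k \<in> K \<Longrightarrow> l \<in> K \<Longrightarrow> Q k \<Longrightarrow> Q l \<Longrightarrow> k = l"
    and "\<And>k. k \<in> K \<Longrightarrow> Q k \<Longrightarrow> g k \<le> c" "0 \<le> c"
  shows "(\<Sum>k\<in>K. if Q k then g k else 0) \<le> c"
  using sum_at_most_one[of K Q g] assms by force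

section \<open>Periodic sums, and arcs sorted by their starts and ends\<close>

lemma periodic_multiple:
  fixes f :: "int \<Rightarrow> 'a"
  assumes "\<And>s. f (s + N) = f s"
  shows "f (s + N * j) = f s"
proof -
  have pos: "f (s + N * int m) = f s" for m s
    by (induction m) (use assms in \<open>auto simp: algebra_simps\<close>, metis assms add.commute)
  show ?thesis
  proof (cases "j \<ge> 0")
    case True then show ?thesis using pos[of s "nat j"] by simp
  next
    case False then show ?thesis using pos[of "s + N * j" "nat (- j)"] by (simp add: algebra_simps)
  qed
qed

lemma periodic_mod:
  fixes f :: "int \<Rightarrow> 'a"
  assumes "\<And>s. f (s + N) = f s"
  shows "f (s mod N) = f s"
  using periodic_multiple[of f N "s mod N" "s div N", OF assms] by (simp add: mod_mult_div_eq)

lemma sum_periodic_shift: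
  fixes f :: "int \<Rightarrow> real"
  assumes "\<And>s. f (s + N) = f s"
  shows "(\<Sum>s\<in>{0..<N}. f (s + c)) = (\<Sum>s\<in>{0..<N}. f s)"
proof (rule sum.reindex_bij_witness[where i = "\<lambda>s. (s - c) mod N" and j = "\<lambda>s. (s + c) mod N"])
  fix s assume "s \<in> {0..<N}"
  then show "((s + c) mod N - c) mod N = s" "((s - c) mod N + c) mod N = s"
    "(s + c) mod N \<in> {0..<N}" "(s - c) mod N \<in> {0..<N}"
    by (auto simp: mod_simps)
  show "f ((s + c) mod N) = f (s + c)" using periodic_mod[of f, OF assms] .
qed

lemma tot_shift:
  assumes "\<And>s k. P (s + N) k = P s k"
  shows "tot N g (\<lambda>s k. P (s + c) k) = tot N g P"
  unfolding tot_def using assms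
  by (intro sum_periodic_shift[of "\<lambda>s. \<Sum>k\<in>{2..N-2}. if P s k then g k else 0"]) simp

lemma tot_by_ends:
  assumes "\<And>s k. P (s + N) k = P s k"
  shows "tot N g P = (\<Sum>s\<in>{0..<N}. \<Sum>k\<in>{2..N-2}. if P (s - k) k then g k else 0)"
proof -
  have "tot N g P = (\<Sum>k\<in>{2..N-2}. \<Sum>s\<in>{0..<N}. if P s k then g k else 0)"
    unfolding tot_def by (rule sum.swap)
  also have "\<dots> = (\<Sum>k\<in>{2..N-2}. \<Sum>s\<in>{0..<N}. if P (s - k) k then g k else 0)"
  proof (rule sum.cong[OF refl])
    fix k
    show "(\<Sum>s\<in>{0..<N}. if P s k then g k else 0) = (\<Sum>s\<in>{0..<N}. if P (s - k) k then g k else 0)"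
      using sum_periodic_shift[of "\<lambda>s. if P s k then g k else 0" N "- k"] assms by simp
  qed
  also have "\<dots> = (\<Sum>s\<in>{0..<N}. \<Sum>k\<in>{2..N-2}. if P (s - k) k then g k else 0)"
    by (rule sum.swap)
  finally show ?thesis .
qed

text \<open>The index \<open>j\<close> stands for the gap between the points \<open>j - 1\<close>
  and \<open>j\<close>.\<close>

definition begins :: "int \<Rightarrow> (int \<Rightarrow> real) \<Rightarrow> (int \<Rightarrow> int \<Rightarrow> bool) \<Rightarrow> int \<Rightarrow> real" where
  "begins N g P j = (\<Sum>k\<in>{2..N-2}. if P j k then g k else 0)"

text \<open>The side condition keeps only arcs that start outside \<open>{0, \<dots>, r - 1}\<close>, so that \<open>begins\<close> and
  \<open>ends\<close> never count the same arc.\<close>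

definition ends :: "int \<Rightarrow> int \<Rightarrow> (int \<Rightarrow> real) \<Rightarrow> (int \<Rightarrow> int \<Rightarrow> bool) \<Rightarrow> int \<Rightarrow> real" where
  "ends N r g P j = (\<Sum>k\<in>{2..N-2}. if P (j - k) k \<and> r + k \<le> j + N then g k else 0)"

text \<open>An arc starting in \<open>{r..<N}\<close> passes \<open>N\<close> and ends at the gap
  \<open>s + k - N\<close> in \<open>{1..<r}\<close>. The condition \<open>r + k \<le> j + N\<close>
  in \<open>ends\<close> says that its start, one period up, is at least \<open>r\<close>; the last
  hypothesis puts that start below \<open>N\<close>.\<close>

lemma tot_slots:
  assumes per: "\<And>s k. P (s + N) k = P s k" and r: "1 \<le> r" "r \<le> N"
    and wrap: "\<And>s k. P s k \<Longrightarrow> r \<le> s \<Longrightarrow> s < N \<Longrightarrow> N < s + k \<and> s + k < N + r"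
    and inside: "\<And>s k. P s k \<Longrightarrow> 0 \<le> s \<Longrightarrow> r \<le> s + k"
  shows "tot N g P = begins N g P 0 + (\<Sum>j\<in>{1..<r}. begins N g P j + ends N r g P j)"
proof -
  have "{0..<N} = {0} \<union> {1..<r} \<union> {r..<N}" using r by auto
  then have "tot N g P = (\<Sum>s\<in>{0} \<union> {1..<r} \<union> {r..<N}. begins N g P s)"
    unfolding tot_def begins_def by simp
  also have "\<dots> = begins N g P 0 + (\<Sum>s\<in>{1..<r}. begins N g P s) + (\<Sum>s\<in>{r..<N}. begins N g P s)"
    using r by (subst sum.union_disjoint; auto)+
  also have "(\<Sum>s\<in>{r..<N}. begins N g P s) = (\<Sum>j\<in>{1..<r}. ends N r g P j)"
  proof -
    have eq: "(\<Sum>s\<in>A. \<Sum>k\<in>B. if Q s k then g k else 0) = (\<Sum>(s,k)\<in>{x\<in>A \<times> B. Q (fst x) (snd x)}. g k)"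
      if "finite A" "finite B" for A B :: "int set" and Q
      using that by (simp add: sum.cartesian_product case_prod_beta sum.inter_filter)
    have 1: "P (s + k - N - k) k = P s k" "P (s - k + N) k = P (s - k) k" "P (s + N - k) k = P (s - k) k" for s k
      using per[of "s - N" k] per[of "s - k" k] by (simp_all add: algebra_simps)
    have 2: "j < k" if "P (j - k) k" "j < r" for j k
      using inside[OF that(1)] that(2) by linarith
    show ?thesis unfolding begins_def ends_def eq[OF finite_atLeastLessThan_int finite_atLeastAtMost_int]
      by (rule sum.reindex_bij_witness[where i = "\<lambda>(j,k). (j - k + N, k)" and j = "\<lambda>(s,k). (s + k - N, k)"])
         (use 1 2 in \<open>auto dest: wrap\<close>)
  qed
  finally show ?thesis by (simp add: sum.distrib)
qed

text \<open>A predicate \<open>P s k\<close> that is periodic in \<open>s\<close> encodes a set of arcs \<open>{s, \<dots>, s + k - 1}\<close> of the cycle of length \<open>N\<close>.\<close>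

locale circ =
  fixes N :: int and P :: "int \<Rightarrow> int \<Rightarrow> bool"
  assumes N_nonneg: "0 \<le> N"
    and per: "P (s + N) k = P s k"
    and rng: "P s k \<Longrightarrow> 2 \<le> k \<and> k \<le> N - 2"
    and anti: "P s k \<Longrightarrow> P t l \<Longrightarrow> t \<le> s \<Longrightarrow> s + k \<le> t + l \<Longrightarrow> s = t \<and> k = l"
    and cross: "P s k \<Longrightarrow> P t l \<Longrightarrow> s + k \<le> t \<Longrightarrow> s + N < t + l"
begin

lemma shifted: "circ N (\<lambda>s k. P (s + c) k)"
proof
  show "0 \<le> N" by (rule N_nonneg)
  fix s k t l
  show "P (s + N + c) k = P (s + c) k" using per[of "s + c" k] by (simp add: algebra_simps)
  show "P (s + c) k \<Longrightarrow> 2 \<le> k \<and> k \<le> N - 2" using rng .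
  show "P (s + c) k \<Longrightarrow> P (t + c) l \<Longrightarrow> t \<le> s \<Longrightarrow> s + k \<le> t + l \<Longrightarrow> s = t \<and> k = l"
    using anti[of "s + c" k "t + c" l] by simp
  show "P (s + c) k \<Longrightarrow> P (t + c) l \<Longrightarrow> s + k \<le> t \<Longrightarrow> s + N < t + l"
    using cross[of "s + c" k "t + c" l] by simp
qed

lemma begins_cases:
  "(\<forall>k. \<not> P j k) \<and> begins N g P j = 0 \<or> (\<exists>k. P j k \<and> begins N g P j = g k)"
proof -
  have eq: "k = l" if "P j k" "P j l" for k l
    using anti[OF that] anti[OF that(2,1)] by (cases "k \<le> l") auto
  have K: "k \<in> {2..N-2}" if "P j k" for k using rng[OF that] by simp
  show ?thesis unfolding begins_def
    using sum_at_most_one[of "{2..N-2}" "P j" g] eq K by blast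
qed

lemma ends_cases:
  "(\<forall>k. P (j - k) k \<longrightarrow> j + N < r + k) \<and> ends N r g P j = 0 \<or>
   (\<exists>k. P (j - k) k \<and> r + k \<le> j + N \<and> ends N r g P j = g k)"
proof -
  have eq: "k = l" if "P (j - k) k" "P (j - l) l" for k l
    using anti[OF that] anti[OF that(2,1)] by (cases "k \<le> l") auto
  have K: "k \<in> {2..N-2}" if "P (j - k) k" for k using rng[OF that] by simp
  show ?thesis unfolding ends_def not_le[symmetric]
    using sum_at_most_one[of "{2..N-2}" "\<lambda>k. P (j - k) k \<and> r + k \<le> j + N" g] eq K by blast
qed

end

text \<open>Every other arc meets the shortest arc \<open>{0, \<dots>, r - 1}\<close> without containing it, so it begins or
  ends at one of the \<open>r - 1\<close> gaps inside that arc.\<close>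

locale circ_small = circ +
  fixes r :: int
  assumes base: "P 0 r" and small: "2 * r \<le> N" and least: "P s k \<Longrightarrow> r \<le> k"
begin

lemma r_ge: "2 \<le> r" using rng[OF base] by simp

text \<open>A later arc must meet the base arc, hence pass \<open>N\<close>; it must not contain the
  next copy of the base arc, hence end before \<open>N + r\<close>.\<close>

lemma base_end: "P s k \<Longrightarrow> r \<le> s \<Longrightarrow> s < N \<Longrightarrow> N < s + k \<and> s + k < N + r"
  using cross[OF base, of s k] anti[of N r s k] base per[of 0 r] r_ge by (cases "N + r \<le> s + k") auto

lemma base_inside: "P s k \<Longrightarrow> 0 \<le> s \<Longrightarrow> r \<le> s + k"
  using anti[of s k 0 r] base by (cases "r \<le> s + k") auto

lemma tot_eq: "tot N g P = g r + (\<Sum>j\<in>{1..<r}. begins N g P j + ends N r g P j)"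
proof -
  have "begins N g P 0 = g r"
  proof -
    obtain k where k: "P 0 k" "begins N g P 0 = g k" using begins_cases[of 0 g] base by blast
    then have "k = r" using anti[OF base k(1)] least[OF k(1)] by simp
    then show ?thesis using k by simp
  qed
  then show ?thesis
    using tot_slots[of P N r g, OF per _ _ base_end base_inside] r_ge small by simp
qed

lemma wt_r: "of_int r * wt N r = of_int N - of_int r + 1"
  using small r_ge by (simp add: wt_def)

lemma wt_ge_one: "1 \<le> wt N r"
  using small r_ge by (simp add: wt_def le_divide_eq)

lemma wt_le: "r \<le> k \<Longrightarrow> wt N k \<le> wt N r"
  using wt_antimono[of r k N] r_ge by simp

text \<open>An arc ending at a gap and an arc beginning there can meet only on the far side of the
  cycle, so their lengths add up to more than \<open>N\<close> and one of them weighs 1.\<close>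

lemma gap: "begins N (wt N) P j + ends N r (wt N) P j \<le> wt N r + 1"
proof -
  consider "begins N (wt N) P j = 0" | k where "P j k" "begins N (wt N) P j = wt N k"
    using begins_cases by blast
  then show ?thesis
  proof cases
    case 1
    then show ?thesis using ends_cases[of j r "wt N"] wt_le least wt_ge_one by fastforce
  next
    case k: 2
    consider "ends N r (wt N) P j = 0" | l where "P (j - l) l" "ends N r (wt N) P j = wt N l"
      using ends_cases[of j r "wt N"] by blast
    then show ?thesis
    proof cases
      case 1
      then show ?thesis using k wt_le least wt_ge_one by fastforce
    next
      case l: 2
      have "N < k + l" using cross[OF l(1) k(1)] by simp
      then have "wt N k = 1 \<or> wt N l = 1" by (auto simp: wt_def)
      then show ?thesis using k l wt_le[OF least[OF k(1)]] wt_le[OF least[OF l(1)]] by linarith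
    qed
  qed
qed

text \<open>The budget: the base arc and \<open>r - 1\<close> gaps of \<open>wt N r + 1\<close> each
  use up exactly \<open>N\<close>.\<close>

lemma wt_total: "wt N r + of_int (r - 1) * (wt N r + 1) = of_int N"
  using wt_r by (simp add: algebra_simps)

lemma tot_le: "tot N (wt N) P \<le> of_int N"
proof -
  have "(\<Sum>j\<in>{1..<r}. begins N (wt N) P j + ends N r (wt N) P j) \<le> (\<Sum>j\<in>{1..<r}. wt N r + 1)"
    by (rule sum_mono) (rule gap)
  also have "\<dots> = of_int (r - 1) * (wt N r + 1)" using r_ge by simp
  finally show ?thesis using tot_eq[of "wt N"] wt_total by linarith
qed

end

section \<open>The weight bound for arbitrary antichains of arcs, and a sharper one\<close>

context circ begin

text \<open>Either all weights are 1 and counting starts is enough, or a shortest arc, rotated to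
  start at 0, serves as base.\<close>

lemma small_or_large:
  obtains (large) "\<And>s k. P s k \<Longrightarrow> N < 2 * k"
  | (small) c r where "circ_small N (\<lambda>s k. P (s + c) k) r"
proof (cases "\<exists>s k. P s k \<and> 2 * k \<le> N")
  case True
  define m where "m = (LEAST m. \<exists>s. P s (int m) \<and> 2 * int m \<le> N)"
  have ex: "\<exists>m s. P s (int m) \<and> 2 * int m \<le> N"
  proof -
    obtain s k where "P s k" "2 * k \<le> N" using True by blast
    then show ?thesis using rng[of s k] by (intro exI[of _ "nat k"] exI[of _ s]) auto
  qed
  then have m: "\<exists>s. P s (int m) \<and> 2 * int m \<le> N" unfolding m_def by (rule LeastI_ex)
  then obtain c where c: "P c (int m)" "2 * int m \<le> N" by blast
  have "int m \<le> k" if "P s k" for s k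
  proof (cases "2 * k \<le> N")
    case True
    have "m \<le> nat k" unfolding m_def by (rule Least_le) (use that True rng[OF that] in auto)
    then show ?thesis using rng[OF that] by linarith
  next
    case False then show ?thesis using c by simp
  qed
  then have "circ_small N (\<lambda>s k. P (s + c) k) (int m)"
    using shifted[of c] c by (intro circ_small.intro circ_small_axioms.intro) auto
  then show ?thesis using small by blast
next
  case False then show ?thesis using large by force
qed

lemma tot_le: "tot N (wt N) P \<le> of_int N"
proof (cases rule: small_or_large)
  case large
  have "begins N (wt N) P s \<le> 1" for s
    using begins_cases[of s "wt N"] large by (auto simp: wt_def dest!: large)
  then have "tot N (wt N) P \<le> (\<Sum>s\<in>{0..<N}. 1)"
    unfolding tot_def begins_def[symmetric] by (intro sum_mono)
  also have "\<dots> = of_int N" using N_nonneg by simp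
  finally show ?thesis .
next
  case (small c r)
  then show ?thesis using circ_small.tot_le[OF small] tot_shift[of P N "wt N" c, OF per] by simp
qed

text \<open>A base arc of length 2 has a single gap. Two arcs at this gap have total length above
  \<open>N\<close> and lengths at most \<open>N - 2\<close>, so both have length at least 3; this
  lowers the gap bound from \<open>wt N 2 + 1\<close> to the maximum of \<open>wt N 2\<close> and
  \<open>wt N 3 + 1\<close>.\<close>

lemma tot_le_pair:
  assumes "P c 2" "6 \<le> N"
  shows "tot N (wt N) P \<le> of_int N - 1"
proof -
  interpret S: circ_small N "\<lambda>s k. P (s + c) k" 2
    using shifted[of c] assms rng by (intro circ_small.intro circ_small_axioms.intro) auto
  let ?P = "\<lambda>s k. P (s + c) k"
  have "{1..<2::int} = {1}" by auto
  then have tot: "tot N (wt N) P = wt N 2 + (begins N (wt N) ?P 1 + ends N 2 (wt N) ?P 1)"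
    using S.tot_eq[of "wt N"] tot_shift[of P N "wt N" c, OF per] by simp
  have w2: "2 * wt N 2 = of_int N - 1" using assms by (simp add: wt_def)
  have w3: "3 * wt N 3 = of_int N - 2" using assms by (simp add: wt_def)
  have pos: "0 \<le> wt N 2" using w2 assms by simp
  have N6: "6 \<le> real_of_int N" using assms by simp
  consider "begins N (wt N) ?P 1 = 0" | "ends N 2 (wt N) ?P 1 = 0"
    | k l where "?P 1 k" "begins N (wt N) ?P 1 = wt N k" "?P (1 - l) l" "ends N 2 (wt N) ?P 1 = wt N l"
    using S.begins_cases[of 1 "wt N"] S.ends_cases[of 1 2 "wt N"] by blast
  then have "begins N (wt N) ?P 1 + ends N 2 (wt N) ?P 1 \<le> max (wt N 2) (wt N 3 + 1)"
  proof cases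
    case 1
    then show ?thesis using S.ends_cases[of 1 2 "wt N"] S.wt_le[OF S.least] pos by fastforce
  next
    case 2
    then show ?thesis using S.begins_cases[of 1 "wt N"] S.wt_le[OF S.least] pos by fastforce
  next
    case 3
    have "N < k + l" using S.cross[OF 3(3,1)] by simp
    moreover have "k \<le> N - 2" "l \<le> N - 2" using S.rng 3(1,3) by auto
    ultimately have "3 \<le> k" "3 \<le> l" "wt N k = 1 \<or> wt N l = 1" by (auto simp: wt_def)
    then have "wt N k + wt N l \<le> wt N 3 + 1"
      using wt_antimono[of 3 k N] wt_antimono[of 3 l N] by linarith
    then show ?thesis using 3 by simp
  qed
  then show ?thesis using tot w2 w3 N6 by linarith
qed

end

section \<open>Butterfly-free families of arcs\<close>

text \<open>For \<open>N \<in> {6, 7, 8}\<close> and \<open>k \<in> {3, N - 3}\<close> the value \<open>q = (9 - N) / 4\<close> is the solution of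
  \<open>X + Y - q X Y = 1\<close> with \<open>X = 2 / k\<close> and \<open>Y = 2 / (N - k)\<close>; for all other \<open>3 \<le> k \<le> N - 3\<close> already \<open>X + Y \<le> 1\<close>.
  A full share \<open>q = 1\<close> would make the averaging trivial, but \<open>tot_cycle\<close> then fails for \<open>N = 8\<close>.\<close>

definition share :: "int \<Rightarrow> int \<Rightarrow> real" where
  "share N k = (if 6 \<le> N \<and> N \<le> 8 \<and> (k = 3 \<or> k = N - 3) then (9 - of_int N) / 4 else 0)"

definition cost :: "int \<Rightarrow> int \<Rightarrow> real" where
  "cost N k = share N k * wt N k"

lemma tot_mono:
  assumes "\<And>s k. P s k \<Longrightarrow> f k \<le> g k"
  shows "tot N f P \<le> tot N g P"
  unfolding tot_def using assms by (intro sum_mono) auto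

lemma tot_add: "tot N (\<lambda>k. f k + g k) P = tot N f P + tot N g P"
  unfolding tot_def by (simp add: sum.distrib[symmetric] if_distrib cong: if_cong)

lemma tot_scale: "tot N (\<lambda>k. c * f k) P = c * tot N f P"
  unfolding tot_def by (simp add: sum_distrib_left if_distrib cong: if_cong)

lemma tot_none: "(\<And>s k. P s k \<Longrightarrow> f k = 0) \<Longrightarrow> tot N f P = 0"
  unfolding tot_def by (intro sum.neutral ballI) auto

text \<open>The trace of a butterfly-free family on a cycle: \<open>X\<close> is the whole trace, \<open>B\<close> consists of the middle
  sets \<open>F\<close> of chains \<open>A \<subset> F \<subset> C\<close> with \<open>A\<close> and \<open>C\<close> arcs as well, and all other arcs are distributed
  over the antichains \<open>P1\<close> and \<open>P2\<close>, which also contain \<open>A\<close> and \<open>C\<close>, respectively.\<close>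

locale butterfly_cycle =
  fixes N :: int and X P1 P2 B :: "int \<Rightarrow> int \<Rightarrow> bool"
  assumes X_per: "X (s + N) k = X s k"
    and X_cross: "X s k \<Longrightarrow> X t l \<Longrightarrow> s + k \<le> t \<Longrightarrow> s + N < t + l"
    and circ1: "circ N P1" and circ2: "circ N P2" and circB: "circ N B"
    and P1_X: "P1 s k \<Longrightarrow> X s k"
    and P2_X: "P2 s k \<Longrightarrow> X s k"
    and B_X: "B s k \<Longrightarrow> X s k"
    and B_rng: "B s k \<Longrightarrow> 3 \<le> k \<and> k \<le> N - 3"
    and P2_three: "P2 s k \<Longrightarrow> 3 \<le> k"
    and above: "B s k \<Longrightarrow> \<exists>t l. P2 t l \<and> t \<le> s \<and> s + k \<le> t + l \<and> k < l"
    and above_unique: "B s k \<Longrightarrow> P2 t l \<Longrightarrow> P2 t' l' \<Longrightarrow> t \<le> s \<Longrightarrow> s + k \<le> t + l \<Longrightarrow>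
      t' \<le> s \<Longrightarrow> s + k \<le> t' + l' \<Longrightarrow> t = t' \<and> l = l'"
    and not_below: "B s k \<Longrightarrow> P2 t l \<Longrightarrow> s \<le> t \<Longrightarrow> t + l \<le> s + k \<Longrightarrow> False"
    and below: "B s k \<Longrightarrow> \<exists>t l. P1 t l \<and> s \<le> t \<and> t + l \<le> s + k \<and> l < k"
    and below_unique: "B s k \<Longrightarrow> X t l \<Longrightarrow> X t' l' \<Longrightarrow> s \<le> t \<Longrightarrow> t + l \<le> s + k \<Longrightarrow> l < k \<Longrightarrow>
      s \<le> t' \<Longrightarrow> t' + l' \<le> s + k \<Longrightarrow> l' < k \<Longrightarrow> t = t' \<and> l = l'"
begin

sublocale first: circ N P1 by (rule circ1)
sublocale second: circ N P2 by (rule circ2)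
sublocale mid: circ N B by (rule circB)

lemma shift: "butterfly_cycle N (\<lambda>s. X (s + c)) (\<lambda>s. P1 (s + c)) (\<lambda>s. P2 (s + c)) (\<lambda>s. B (s + c))"
proof (intro butterfly_cycle.intro)
  fix s k t l t' l'
  show "X (s + N + c) k = X (s + c) k" using X_per[of "s + c" k] by (simp add: algebra_simps)
  show "X (s + c) k \<Longrightarrow> X (t + c) l \<Longrightarrow> s + k \<le> t \<Longrightarrow> s + N < t + l"
    using X_cross[of "s + c" k "t + c" l] by simp
  show "B (s + c) k \<Longrightarrow> \<exists>t l. P2 (t + c) l \<and> t \<le> s \<and> s + k \<le> t + l \<and> k < l"
  proof -
    assume "B (s + c) k"
    then obtain t l where "P2 t l \<and> t \<le> s + c \<and> s + c + k \<le> t + l \<and> k < l" using above by blast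
    then show ?thesis by (intro exI[of _ "t - c"] exI[of _ l]) auto
  qed
  show "B (s + c) k \<Longrightarrow> \<exists>t l. P1 (t + c) l \<and> s \<le> t \<and> t + l \<le> s + k \<and> l < k"
  proof -
    assume "B (s + c) k"
    then obtain t l where "P1 t l \<and> s + c \<le> t \<and> t + l \<le> s + c + k \<and> l < k" using below by blast
    then show ?thesis by (intro exI[of _ "t - c"] exI[of _ l]) auto
  qed
  show "B (s + c) k \<Longrightarrow> P2 (t + c) l \<Longrightarrow> P2 (t' + c) l' \<Longrightarrow> t \<le> s \<Longrightarrow> s + k \<le> t + l \<Longrightarrow>
      t' \<le> s \<Longrightarrow> s + k \<le> t' + l' \<Longrightarrow> t = t' \<and> l = l'"
    using above_unique[of "s + c" k "t + c" l "t' + c" l'] by simp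
  show "B (s + c) k \<Longrightarrow> P2 (t + c) l \<Longrightarrow> s \<le> t \<Longrightarrow> t + l \<le> s + k \<Longrightarrow> False"
    using not_below[of "s + c" k "t + c" l] by simp
  show "B (s + c) k \<Longrightarrow> X (t + c) l \<Longrightarrow> X (t' + c) l' \<Longrightarrow> s \<le> t \<Longrightarrow> t + l \<le> s + k \<Longrightarrow> l < k \<Longrightarrow>
      s \<le> t' \<Longrightarrow> t' + l' \<le> s + k \<Longrightarrow> l' < k \<Longrightarrow> t = t' \<and> l = l'"
    using below_unique[of "s + c" k "t + c" l "t' + c" l'] by simp
qed (use first.shifted second.shifted mid.shifted P1_X P2_X B_X B_rng P2_three in blast)+

lemma three_below: "B s 3 \<Longrightarrow> \<exists>t. P1 t 2 \<and> s \<le> t \<and> t \<le> s + 1"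
  using below[of s 3] first.rng by (smt (verit))

text \<open>A middle arc of length 3 contains a pair from \<open>X\<close> that meets the pair at 0,
  so up to multiples of \<open>N\<close> it starts in \<open>{-2..1}\<close>. Starts 0 and 1 exclude
  each other, as do -2 and -1: one of the two arcs would contain two pairs, against
  \<open>below_unique\<close>.\<close>

lemma three_arcs_based:
  assumes "B s0 3" "X 0 2" "s0 \<le> 0" "2 \<le> s0 + 3" "6 \<le> N"
  shows "tot N (\<lambda>k. if k = 3 then 1 else 0) B \<le> 2"
proof -
  let ?b = "\<lambda>s. of_bool (B s 3) :: real"
  have X: "\<exists>t. X t 2 \<and> s \<le> t \<and> t \<le> s + 1" if "B s 3" for s
    using three_below[OF that] P1_X by blast
  have near: "s \<in> {-2,-1,0,1}" if asm: "B s 3" "-2 \<le> s" "s \<le> N - 3" for s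
  proof -
    obtain t where t: "X t 2" "s \<le> t" "t \<le> s + 1" using X asm(1) by blast
    have "X (t - N) 2" using t(1) X_per[of "t - N" 2] by simp
    then have "t < 2 \<or> N - 2 < t" using X_cross[OF assms(2) t(1)] by linarith
    moreover have "N - 2 < t \<Longrightarrow> t \<ge> N - 1" by simp
    ultimately show ?thesis using t asm X_cross[OF \<open>X (t - N) 2\<close> assms(2)] by auto
  qed
  have "tot N (\<lambda>k. if k = 3 then 1 else 0) B = (\<Sum>s\<in>{0..<N}. ?b s)"
    unfolding tot_def
  proof (rule sum.cong[OF refl])
    fix s
    have "(\<Sum>k\<in>{2..N-2}. if B s k then if k = 3 then 1 else 0 else 0)
        = (\<Sum>k\<in>{2..N-2}. if k = 3 then ?b s else 0)"
      by (rule sum.cong) auto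
    then show "(\<Sum>k\<in>{2..N-2}. if B s k then if k = 3 then 1 else 0 else 0) = ?b s"
      using assms(5) by simp
  qed
  \<comment> \<open>The shift moves the period to \<open>{-2..N - 3}\<close>, the window of
    \<open>near\<close>.\<close>
  also have "\<dots> = (\<Sum>s\<in>{0..<N}. ?b (s + -2))"
    by (rule sum_periodic_shift[symmetric]) (simp add: mid.per)
  also have "\<dots> = (\<Sum>s\<in>{0,1,2,3}. ?b (s + -2))"
    by (rule sum.mono_neutral_right) (use assms(5) near in force)+
  also have "\<dots> = ?b (-2) + ?b (-1) + ?b 0 + ?b 1" by simp
  also have "\<dots> \<le> 2"
  proof -
    have 1: "\<not> B 0 3" if "B 1 3"
    proof
      assume "B 0 3"
      obtain t where t: "X t 2" "1 \<le> t" "t \<le> 2" using X[OF \<open>B 1 3\<close>] by auto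
      then have "t = 1" using X_cross[OF assms(2) t(1)] assms(5) by linarith
      then show False using below_unique[OF \<open>B 0 3\<close> assms(2) t(1)] by simp
    qed
    have 2: "\<not> B (-1) 3" if "B (-2) 3"
    proof
      assume "B (-1) 3"
      obtain t where t: "X t 2" "-2 \<le> t" "t \<le> -1" using X[OF \<open>B (-2) 3\<close>] by auto
      then have "t = -1" using X_cross[OF t(1) assms(2)] assms(5) by linarith
      then show False using below_unique[OF \<open>B (-1) 3\<close> assms(2) t(1)] by simp
    qed
    show ?thesis using 1 2 by (auto simp: of_bool_def)
  qed
  finally show ?thesis .
qed

lemma three_arcs:
  assumes "6 \<le> N"
  shows "tot N (\<lambda>k. if k = 3 then 1 else 0) B \<le> 2"
proof (cases "\<exists>s. B s 3")
  case True
  then obtain s t where st: "B s 3" "P1 t 2" "s \<le> t" "t \<le> s + 1" using three_below by blast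
  interpret S: butterfly_cycle N "\<lambda>s. X (s + t)" "\<lambda>s. P1 (s + t)" "\<lambda>s. P2 (s + t)" "\<lambda>s. B (s + t)"
    by (rule shift)
  have "tot N (\<lambda>k. if k = 3 then 1 else 0) (\<lambda>s. B (s + t)) \<le> 2"
    using S.three_arcs_based[of "s - t"] st assms P1_X by simp
  then show ?thesis using tot_shift[of B N _ t, OF mid.per] by simp
next
  case False
  then show ?thesis by (subst tot_none) auto
qed

text \<open>A middle arc shares at most one of its two end points with an arc of \<open>P2\<close>, so it leaves
  a starting point or an end point unused by \<open>P2\<close>.\<close>

lemma large_bound:
  assumes large: "\<And>s k. P2 s k \<Longrightarrow> N < 2 * k"
  shows "tot N (wt N) P2 + tot N (\<lambda>_. 1 / 2) B \<le> of_int N"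
proof -
  let ?one = "\<lambda>_::int. 1 :: real"
  let ?S = "\<lambda>s k. B s k \<and> (\<forall>l. \<not> P2 s l)"
  let ?E = "\<lambda>s k. B s k \<and> (\<forall>l. \<not> P2 (s + k - l) l)"
  have split: "?S s k \<or> ?E s k" if b: "B s k" for s k
  proof (rule ccontr)
    assume "\<not> ?thesis"
    then obtain l l' where l: "P2 s l" "P2 (s + k - l') l'" using b by blast
    \<comment> \<open>One \<open>P2\<close> arc begins where the middle arc begins, the other ends
      where it ends. Both contain it properly, so by uniqueness they would coincide.\<close>
    have "k < l" "k < l'" using not_below[OF b l(1)] not_below[OF b l(2)] by force+
    then show False using above_unique[OF b l] by simp
  qed
  have one: "(\<Sum>k\<in>{2..N-2}. if Q k then 1 else 0 :: real) \<le> 1" if "\<And>k l. Q k \<Longrightarrow> Q l \<Longrightarrow> k = l" for Q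
    by (rule sum_at_most_one_le) (use that in auto)
  have zero: "(\<Sum>k\<in>{2..N-2}. if Q k then 1 else 0 :: real) = 0" if "\<And>k. \<not> Q k" for Q
    by (rule sum.neutral) (use that in auto)
  have same: "k = l" if "circ N Q" "Q s k" "Q s l" for Q s k l
    using circ.anti[OF that] circ.anti[OF that(1,3,2)] by (cases "k \<le> l") auto
  have same_end: "k = l" if "circ N Q" "Q (s - k) k" "Q (s - l) l" for Q s k l
    using circ.anti[OF that] circ.anti[OF that(1,3,2)] by (cases "k \<le> l") auto
  have "tot N (wt N) P2 = tot N ?one P2"
    unfolding tot_def by (intro sum.cong refl) (auto simp: wt_def dest: large)
  moreover have "tot N ?one P2 + tot N ?one ?S \<le> of_int N"
  proof -
    have "tot N ?one P2 + tot N ?one ?S \<le> (\<Sum>s\<in>{0..<N}. 1)"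
      unfolding tot_def
    proof (subst sum.distrib[symmetric], rule sum_mono)
      fix s
      show "(\<Sum>k\<in>{2..N-2}. if P2 s k then 1 else 0) + (\<Sum>k\<in>{2..N-2}. if ?S s k then 1 else 0) \<le> (1::real)"
        using one[of "P2 s"] one[of "?S s"] same[OF circ2, of s] same[OF circB, of s] zero[of "P2 s"] zero[of "?S s"]
        by (cases "\<exists>l. P2 s l") auto
    qed
    then show ?thesis using second.N_nonneg by simp
  qed
  moreover have "tot N ?one P2 + tot N ?one ?E \<le> of_int N"
  proof -
    have per: "?E (s + N) k = ?E s k" for s k
    proof -
      have "P2 (s + N + k - l) l = P2 (s + k - l) l" for l
        using second.per[of "s + k - l" l] by (simp add: algebra_simps)
      then show ?thesis using mid.per by simp
    qed
    have "tot N ?one P2 + tot N ?one ?E \<le> (\<Sum>s\<in>{0..<N}. 1)"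
      unfolding tot_by_ends[of P2, OF second.per] tot_by_ends[of ?E, OF per]
    proof (subst sum.distrib[symmetric], rule sum_mono)
      fix s
      show "(\<Sum>k\<in>{2..N-2}. if P2 (s - k) k then 1 else 0) + (\<Sum>k\<in>{2..N-2}. if ?E (s - k) k then 1 else 0) \<le> (1::real)"
        using one[of "\<lambda>k. P2 (s - k) k"] one[of "\<lambda>k. ?E (s - k) k"] same_end[OF circ2, of s] same_end[OF circB, of s]
          zero[of "\<lambda>k. P2 (s - k) k"] zero[of "\<lambda>k. ?E (s - k) k"]
        by (cases "\<exists>l. P2 (s - l) l") auto
    qed
    then show ?thesis using second.N_nonneg by simp
  qed
  \<comment> \<open>Adding the two bounds above counts \<open>P2\<close> twice and every middle arc
    at least once, whence the factor 1/2.\<close>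
  moreover have "tot N ?one B \<le> tot N ?one ?S + tot N ?one ?E"
    unfolding tot_def sum.distrib[symmetric] by (intro sum_mono) (use split in auto)
  moreover have "tot N (\<lambda>_. 1 / 2) B = 1 / 2 * tot N ?one B"
    using tot_scale[of N "1/2" ?one B] by simp
  ultimately show ?thesis by linarith
qed

end

lemma wt_nonneg: "0 \<le> k \<Longrightarrow> 0 \<le> wt N k"
  by (simp add: wt_def)

context circ begin

lemma begins_le:
  assumes "0 < m" "\<And>k. P j k \<Longrightarrow> m \<le> k"
  shows "begins N (wt N) P j \<le> wt N m"
  using begins_cases[of j "wt N"] wt_antimono[OF assms(1) assms(2)] wt_nonneg[of m N] assms(1) by fastforce

lemma ends_le:
  assumes "0 < m" "\<And>k. P (j - k) k \<Longrightarrow> m \<le> k"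
  shows "ends N r (wt N) P j \<le> wt N m"
  using ends_cases[of j r "wt N"] wt_antimono[OF assms(1) assms(2)] wt_nonneg[of m N] assms(1) by fastforce

end

section \<open>Middle arcs when the upper antichain has a short arc\<close>

locale butterfly_small = butterfly_cycle N X P1 P2 B + sm: circ_small N P2 r for N X P1 P2 B r
begin

text \<open>Middle arcs and \<open>P2\<close> together need not form an antichain, but no middle arc
  contains the base arc. This gives the same decomposition, with nothing at gap 0, where an arc of
  length at least \<open>r\<close> would contain the base.\<close>

lemma slots:
  assumes Q: "circ N Q" "\<And>s k. Q s k \<Longrightarrow> B s k \<and> r \<le> k"
  shows "tot N g Q = (\<Sum>j\<in>{1..<r}. begins N g Q j + ends N r g Q j)"
proof -
  have "\<not> Q 0 k" for k
    using Q(2)[of 0 k] not_below[of 0 k 0 r] sm.base by auto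
  then have "begins N g Q 0 = 0"
    using circ.begins_cases[OF Q(1), of 0 g] by blast
  moreover have "N < s + k \<and> s + k < N + r" if "Q s k" "r \<le> s" "s < N" for s k
  proof
    show "N < s + k" using X_cross[OF P2_X[OF sm.base] B_X, of s k] that Q(2) by simp
    show "s + k < N + r"
    proof (rule ccontr)
      assume "\<not> ?thesis"
      then show False using not_below[of s k N r] Q(2)[OF that(1)] second.per[of 0 r] sm.base that by simp
    qed
  qed
  moreover have "r \<le> s + k" if "Q s k" "0 \<le> s" for s k
    using Q(2)[OF that(1)] that(2) by simp
  ultimately show ?thesis
    using tot_slots[of Q N r g, OF circ.per[OF Q(1)]] sm.r_ge sm.small by simp
qed

lemma tot_P2: "tot N (wt N) P2 = wt N r + (\<Sum>j\<in>{1..<r}. begins N (wt N) P2 j + ends N r (wt N) P2 j)"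
  by (rule sm.tot_eq)

lemma begins_mid: "B j d \<Longrightarrow> P2 j k \<Longrightarrow> d < k"
  using not_below[of j d j k] by force

lemma ends_mid: "B (j - d) d \<Longrightarrow> P2 (j - k) k \<Longrightarrow> d < k"
  using not_below[of "j - d" d "j - k" k] by force

lemma begins_mid_cross: "B j d \<Longrightarrow> X (j - k) k \<Longrightarrow> N < d + k"
  using X_cross[of "j - k" k j d] B_X by simp

lemma ends_mid_cross: "B (j - d) d \<Longrightarrow> X j k \<Longrightarrow> N < d + k"
  using X_cross[of "j - d" d j k] B_X by simp

text \<open>A middle arc of length \<open>d\<close> beginning at a gap forces a \<open>P2\<close>
  arc beginning there to be longer than \<open>d\<close>, and one ending there, which must meet it
  on the far side, to be longer than \<open>N - d\<close>. The weight lost by \<open>P2\<close> pays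
  for the middle arc.\<close>

lemma gap_cases:
  fixes f :: "int \<Rightarrow> real"
  assumes Q: "circ N Q" "\<forall>s k. Q s k \<longrightarrow> B s k"
  obtains (none) "begins N f Q j = 0" "ends N r f Q j = 0"
  | (starts) d where "Q j d" "begins N f Q j = f d" "ends N r f Q j = 0"
      "begins N (wt N) P2 j \<le> wt N (d + 1)" "ends N r (wt N) P2 j \<le> wt N (N - d + 1)"
  | (stops) d where "Q (j - d) d" "ends N r f Q j = f d" "begins N f Q j = 0"
      "begins N (wt N) P2 j \<le> wt N (N - d + 1)" "ends N r (wt N) P2 j \<le> wt N (d + 1)"
  | (both) d d' where "Q j d" "Q (j - d') d'" "begins N f Q j = f d" "ends N r f Q j = f d'" "N < d + d'"
      "begins N (wt N) P2 j \<le> wt N (d + 1)" "ends N r (wt N) P2 j \<le> wt N (d' + 1)"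
proof -
  have b: "begins N (wt N) P2 j \<le> wt N (d + 1)" "ends N r (wt N) P2 j \<le> wt N (N - d + 1)" if "Q j d" for d
    using second.begins_le[of "d + 1" j] second.ends_le[of "N - d + 1" j r] begins_mid[of j d]
      begins_mid_cross[of j d] B_rng[of j d] Q(2)[rule_format, OF that] P2_X by fastforce+
  have e: "begins N (wt N) P2 j \<le> wt N (N - d + 1)" "ends N r (wt N) P2 j \<le> wt N (d + 1)" if "Q (j - d) d" for d
    using second.begins_le[of "N - d + 1" j] second.ends_le[of "d + 1" j r] ends_mid[of j d]
      ends_mid_cross[of j d] B_rng[of "j - d" d] Q(2)[rule_format, OF that] P2_X by fastforce+
  have c: "N < d + d'" if "Q j d" "Q (j - d') d'" for d d'
    using begins_mid_cross[of j d d'] B_X Q(2) that by blast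
  show ?thesis
    using circ.begins_cases[OF Q(1), of j f] circ.ends_cases[OF Q(1), of j r f] none starts stops both b e c
    by metis
qed

lemma B_B: "\<forall>s k. B s k \<longrightarrow> B s k" by simp

lemmas gap_cases_all = gap_cases[of B, OF circB, OF B_B, consumes 0, case_names none starts stops both]

text \<open>The lower arcs of two middle arcs on both sides of a gap must again meet on the far
  side, although they are shorter.\<close>

lemma below_pair:
  assumes "B j d" "B (j - d') d'"
  obtains t l t' l' where "X t l" "X t' l'" "j \<le> t" "t + l \<le> j + d" "l < d"
    "j - d' \<le> t'" "t' + l' \<le> j" "l' < d'" "2 \<le> l" "2 \<le> l'" "t' + N < t + l"
proof -
  obtain t l where 1: "P1 t l" "j \<le> t" "t + l \<le> j + d" "l < d" using below[OF assms(1)] by blast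
  obtain t' l' where 2: "P1 t' l'" "j - d' \<le> t'" "t' + l' \<le> j" "l' < d'" using below[OF assms(2)] by auto
  have "t' + N < t + l" using X_cross[OF P1_X[OF 2(1)] P1_X[OF 1(1)]] 1 2 by simp
  then show ?thesis using that[OF P1_X[OF 1(1)] P1_X[OF 2(1)] 1(2-4) 2(2-4)] first.rng 1(1) 2(1) by blast
qed

lemma base_meets: "X t l \<Longrightarrow> r \<le> t \<Longrightarrow> N < t + l"
  using X_cross[OF P2_X[OF sm.base], of t l] by simp

lemma meets_base: "X t l \<Longrightarrow> t + l \<le> 0 \<Longrightarrow> t + N < r"
  using X_cross[OF _ P2_X[OF sm.base], of t l] by simp

text \<open>Here \<open>r = 3\<close> and 7 = 5/3 + 2 * 8/3, so each gap has budget 8/3. Next to a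
  single middle arc, \<open>P2\<close> uses at most 1 + 1, whence the value 2/3. Two middle arcs at
  one gap would both have length 4, and their lower arcs could not meet both each other and the base
  arc.\<close>

lemma tot7:
  assumes N: "N = 7"
  shows "tot N (wt N) P2 + tot N (\<lambda>k. if k = 3 then 2/3 else 1/2) B \<le> 7"
proof -
  let ?f = "\<lambda>k::int. if k = 3 then 2/3 else 1/2 :: real"
  have r: "r = 3" using P2_three[OF sm.base] sm.small N by simp
  have w: "wt N 3 = 5/3" "wt N 4 = 1" "wt N 5 = 1" using N by (simp_all add: wt_def)
  have rng: "d = 3 \<or> d = 4" if "B s d" for s d using B_rng[OF that] N by auto
  have gap: "begins N (wt N) P2 j + ends N r (wt N) P2 j + (begins N ?f B j + ends N r ?f B j) \<le> 8/3"
    if j: "1 \<le> j" "j \<le> 2" for j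
  proof (cases rule: gap_cases_all[where f = ?f and j = j])
    case none
    then show ?thesis using sm.gap[of j] r w by simp
  next
    case (starts d)
    then show ?thesis using rng[OF starts(1)] N w by auto
  next
    case (stops d)
    then show ?thesis using rng[OF stops(1)] N w by auto
  next
    case (both d d')
    have d: "d = 4" "d' = 4" using both(5) rng[OF both(1)] rng[OF both(2)] N by auto
    obtain t l t' l' where A: "X t l" "X t' l'" "j \<le> t" "t + l \<le> j + d" "l < d"
      "j - d' \<le> t'" "t' + l' \<le> j" "l' < d'" "2 \<le> l" "2 \<le> l'" "t' + N < t + l"
      using below_pair[OF both(1,2)] by blast
    have "t < 3" using base_meets[OF A(1)] A d N r j by linarith
    moreover have "0 < t' + l'" using meets_base[OF A(2)] A d N r j by linarith
    ultimately have False using A d N r j by linarith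
    then show ?thesis ..
  qed
  have "{1..<r} = {1,2}" using r by auto
  moreover have "tot N ?f B = (\<Sum>j\<in>{1..<r}. begins N ?f B j + ends N r ?f B j)"
    by (rule slots[OF circB]) (use B_rng r in auto)
  ultimately show ?thesis using tot_P2 gap[of 1] gap[of 2] r w by simp
qed

text \<open>Two gaps share 7 - 4/3 = 17/3, and a gap with a middle arc may reach 3. Next to a gap
  bounded by 7/3 this is affordable; if both gaps exceed 7/3, either \<open>P2\<close> leaves a slot
  vacant at one of them or the configuration is impossible.\<close>

lemma tot6:
  assumes N: "N = 6"
  shows "tot N (wt N) P2 + tot N (\<lambda>_. 1) B \<le> 7"
proof -
  let ?f = "\<lambda>_::int. 1 :: real"
  let ?g = "\<lambda>j. begins N (wt N) P2 j + ends N r (wt N) P2 j + (begins N ?f B j + ends N r ?f B j)"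
  have r: "r = 3" using P2_three[OF sm.base] sm.small N by simp
  have w: "wt N 3 = 4/3" "wt N 4 = 1" using N by (simp_all add: wt_def)
  have rng: "d = 3" if "B s d" for s d using B_rng[OF that] N by auto
  have three: "3 \<le> k" "k \<le> 4" if "P2 s k" for s k using P2_three[OF that] second.rng[OF that] N by auto
  have gap: "?g j \<le> 7/3 \<or> ?g j \<le> 3 \<and> (B j 3 \<and> begins N (wt N) P2 j \<le> 1 \<and> ends N r (wt N) P2 j \<le> 1 \<and> begins N ?f B j + ends N r ?f B j = 1
     \<or> B (j - 3) 3 \<and> begins N (wt N) P2 j \<le> 1 \<and> ends N r (wt N) P2 j \<le> 1 \<and> begins N ?f B j + ends N r ?f B j = 1)" for j
  proof (cases rule: gap_cases_all[where f = ?f and j = j])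
    case none
    then show ?thesis using sm.gap[of j] r w by simp
  next
    case (starts d)
    then show ?thesis using rng[OF starts(1)] N w by auto
  next
    case (stops d)
    then show ?thesis using rng[OF stops(1)] N w by auto
  next
    case (both d d')
    then show ?thesis using rng[of j d] rng[of "j - d'" d'] N by simp
  qed
  have two: "?g 1 \<le> 2 \<or> ?g 2 \<le> 2" if big: "\<not> ?g 1 \<le> 7/3" "\<not> ?g 2 \<le> 7/3"
  proof -
    consider (ss) "B 1 3" "B 2 3" | (se) "B 1 3" "B (-1) 3" | (es) "B (-2) 3" "B 2 3" | (ee) "B (-2) 3" "B (-1) 3"
    proof -
      have "B 1 3 \<or> B (1 - 3) 3" using gap[of 1] big(1) by blast
      moreover have "B 2 3 \<or> B (2 - 3) 3" using gap[of 2] big(2) by blast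
      moreover have "(1::int) - 3 = -2" "(2::int) - 3 = -1" by simp_all
      ultimately show ?thesis using ss se es ee by metis
    qed
    then show ?thesis
    proof cases
      case ss
      \<comment> \<open>The \<open>P2\<close> arc of length 4 above the middle arc at 1 cannot start
        at 0, where it would contain the base. It starts at 1 and so also contains the middle arc at
        2, which has only one \<open>P2\<close> arc above it.\<close>
      obtain t l where C: "P2 t l" "t \<le> 1" "4 \<le> t + l" "3 < l" using above[OF ss(1)] by auto
      have "l = 4" using three[OF C(1)] C by simp
      moreover have "t \<noteq> 0" using second.anti[OF sm.base C(1)] C r by auto
      ultimately have C1: "P2 1 4" using C by (cases "t = 1") auto
      have "\<not> P2 2 k" for k
        using above_unique[OF ss(2) C1, of 2 k] begins_mid[OF ss(2), of k] by auto
      then have "begins N (wt N) P2 2 = 0" using second.begins_cases[of 2 "wt N"] by blast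
      then show ?thesis using gap[of 2] big by linarith
    next
      case se
      \<comment> \<open>The lower pairs must share the point 1, so the first is
        \<open>{1, 2}\<close>; a \<open>P2\<close> arc of length 4 ending at gap 1 would miss
        it.\<close>
      obtain t l t' l' where A: "X t l" "X t' l'" "1 \<le> t" "t + l \<le> 4" "l < 3"
         "-1 \<le> t'" "t' + l' \<le> 2" "l' < 3" "2 \<le> l" "2 \<le> l'"
      proof -
        obtain t l where 1: "P1 t l" "1 \<le> t" "t + l \<le> 4" "l < 3" using below[OF se(1)] by auto
        obtain t' l' where 2: "P1 t' l'" "-1 \<le> t'" "t' + l' \<le> 2" "l' < 3" using below[OF se(2)] by auto
        show ?thesis using that[OF P1_X[OF 1(1)] P1_X[OF 2(1)]] 1 2 first.rng[OF 1(1)] first.rng[OF 2(1)] by blast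
      qed
      have "t < t' + l'" using X_cross[OF A(2,1)] A N by linarith
      then have t: "t = 1" "l = 2" using A by auto
      have "\<not> P2 (1 - k) k" for k
      proof
        assume k: "P2 (1 - k) k"
        have "k = 4" using begins_mid_cross[OF se(1) P2_X[OF k]] three[OF k] N by simp
        then show False using X_cross[OF P2_X[OF k] A(1)] t N by simp
      qed
      then have "ends N r (wt N) P2 1 = 0" using second.ends_cases[of 1 r "wt N"] by blast
      then show ?thesis using gap[of 1] big by linarith
    next
      case es
      obtain t l where A: "P1 t l" "2 \<le> t" "t + l \<le> 5" "l < 3" using below[OF es(2)] by auto
      obtain t' l' where A': "P1 t' l'" "-2 \<le> t'" "t' + l' \<le> 1" "l' < 3" using below[OF es(1)] by auto
      have l: "l = 2" "l' = 2" using first.rng[OF A(1)] first.rng[OF A'(1)] A A' by auto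
      have "t' + 6 < t + l" using X_cross[OF P1_X[OF A'(1)] P1_X[OF A(1)]] A A' N by linarith
      then have "t = 3" using A A' l by linarith
      then have False using base_meets[OF P1_X[OF A(1)]] l r N by simp
      then show ?thesis ..
    next
      case ee
      obtain t l where C: "P2 t l" "t \<le> -1" "2 \<le> t + l" "3 < l" using above[OF ee(2)] by auto
      have "l = 4" using three[OF C(1)] C by simp
      moreover have "t \<noteq> -1" using second.anti[OF sm.base C(1)] C r \<open>l = 4\<close> by auto
      ultimately have C1: "P2 (-2) 4" using C by (cases "t = -2") auto
      have "\<not> P2 (1 - k) k" for k
        using above_unique[OF ee(1) C1, of "1 - k" k] ends_mid[of 1 3 k] ee by auto
      then have "ends N r (wt N) P2 1 = 0" using second.ends_cases[of 1 r "wt N"] by blast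
      then show ?thesis using gap[of 1] big by linarith
    qed
  qed
  have "{1..<r} = {1,2}" using r by auto
  moreover have "tot N ?f B = (\<Sum>j\<in>{1..<r}. begins N ?f B j + ends N r ?f B j)"
    by (rule slots[OF circB]) (use B_rng r in auto)
  ultimately have "tot N (wt N) P2 + tot N ?f B = 4/3 + (?g 1 + ?g 2)"
    using tot_P2 r w by simp
  moreover have "?g 1 \<le> 3" "?g 2 \<le> 3" using gap[of 1] gap[of 2] by linarith+
  ultimately show ?thesis using two by linarith
qed

text \<open>For \<open>N = 8\<close> the gaps pay only for middle arcs of length 5: those of length
  4 cost nothing, and those of length 3 are paid from the extra unit in
  \<open>tot_small\<close>.\<close>

lemma circ_length: "circ N (\<lambda>s k. B s k \<and> k = c)"
proof
  show "0 \<le> N" by (rule mid.N_nonneg)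
qed (use mid.per mid.rng mid.anti mid.cross in blast)+

lemma length_B: "\<forall>s k. B s k \<and> k = c \<longrightarrow> B s k" by simp

lemmas gap_cases_five = gap_cases[OF circ_length[of 5] length_B[of 5], consumes 0, case_names none starts stops both]

text \<open>Since 8 = 2 + 2 * 3, each gap has budget 3, while a gap with middle arcs of length 5
  uses at most 5/2.\<close>

lemma tot8_three:
  assumes N: "N = 8" and r: "r = 3"
  shows "tot N (wt N) P2 + tot N (\<lambda>_. 1/4) (\<lambda>s k. B s k \<and> k = 5) \<le> 8"
proof -
  let ?f = "\<lambda>_::int. 1/4 :: real" and ?Q = "\<lambda>s k. B s k \<and> k = (5::int)"
  have w: "wt N 3 = 2" "wt N 4 = 5/4" "wt N 5 = 1" "wt N 6 = 1" using N by (simp_all add: wt_def)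
  have gap: "begins N (wt N) P2 j + ends N r (wt N) P2 j + (begins N ?f ?Q j + ends N r ?f ?Q j) \<le> 3" for j
  proof (cases rule: gap_cases_five[where f = ?f and j = j])
    case none
    then show ?thesis using sm.gap[of j] r w by simp
  qed (use N w in simp)+
  have "{1..<r} = {1,2}" using r by auto
  moreover have "tot N ?f ?Q = (\<Sum>j\<in>{1..<r}. begins N ?f ?Q j + ends N r ?f ?Q j)"
    by (rule slots[OF circ_length]) (use r in auto)
  ultimately show ?thesis using tot_P2 gap[of 1] gap[of 2] r w by simp
qed

text \<open>A middle arc of length 5 lies below a \<open>P2\<close> arc of length 6. Such a long arc
  leaves a slot of \<open>P2\<close> vacant at one of the three gaps, and one vacancy outweighs all
  excesses.\<close>

lemma tot8_four:
  assumes N: "N = 8" and r: "r = 4"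
  shows "tot N (wt N) P2 + tot N (\<lambda>_. 1/4) (\<lambda>s k. B s k \<and> k = 5) \<le> 8"
proof (cases "\<exists>s. B s 5")
  case False
  then have "tot N (\<lambda>_. 1/4) (\<lambda>s k. B s k \<and> k = 5) = 0" by (intro tot_none) auto
  then show ?thesis using second.tot_le N by simp
next
  case True
  \<comment> \<open>Each gap exceeds its budget 9/4 by at most 1/4, and a gap with a free slot falls short of it by 3/4.\<close>
  let ?f = "\<lambda>_::int. 1/4 :: real" and ?Q = "\<lambda>s k. B s k \<and> k = (5::int)"
  let ?p = "begins N (wt N) P2" and ?q = "ends N r (wt N) P2"
  let ?g = "\<lambda>j. ?p j + ?q j + (begins N ?f ?Q j + ends N r ?f ?Q j)"
  have w: "wt N 4 = 5/4" "wt N 5 = 1" "wt N 6 = 1" using N by (simp_all add: wt_def)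
  have p: "?p j \<le> 5/4" "?q j \<le> 5/4" for j
    using second.begins_le[of 4 j] second.ends_le[of 4 j r] sm.least r w by auto
  have gap: "?g j \<le> 5/2 \<and> (?p j = 0 \<or> ?q j = 0 \<longrightarrow> ?g j \<le> 3/2)" for j
  proof (cases rule: gap_cases_five[where f = ?f and j = j])
    case none
    then show ?thesis using sm.gap[of j] p[of j] r w by auto
  qed (use N w in auto)
  have six: "k \<le> 6" "4 \<le> k" if "P2 s k" for s k using second.rng[OF that] sm.least[OF that] N r by auto
  have "\<exists>t. P2 t 6 \<and> t \<in> {1,2,3,4,5}"
  proof -
    obtain s where "B s 5" using True by blast
    then obtain t l where "P2 t l" "5 < l" using above by blast
    moreover from this have "l = 6" using six(1)[of t l] by simp
    ultimately have "P2 t 6" by simp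
    then have t: "P2 (t mod 8) 6" using periodic_mod[of "\<lambda>s. P2 s 6" N t, OF second.per] N by simp
    have "t mod 8 \<noteq> 0" using second.anti[OF sm.base, of 0 6] t r by auto
    moreover have "0 \<le> t mod 8" "t mod 8 < 8" by auto
    moreover have "t mod 8 < 6" if "4 \<le> t mod 8" using sm.base_end[OF t] that r N by simp
    ultimately have "t mod 8 \<in> {1,2,3,4,5}" unfolding insert_iff empty_iff by linarith
    then show ?thesis using t by blast
  qed
  \<comment> \<open>An arc of length 6 with start 3 vacates a slot at gap 1. For starts 1, 2, 4 and
    5, either a slot is vacant or another such arc starts one step nearer to 3.\<close>
  moreover have 3: "?q 1 = 0" if "P2 3 6"
  proof -
    \<comment> \<open>Length 6 is left out because such an arc starts at 3, up to a period, and is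
      counted by \<open>begins\<close>.\<close>
    have "\<not> (P2 (1 - k) k \<and> k \<le> 5)" for k
    proof
      assume k: "P2 (1 - k) k \<and> k \<le> 5"
      then have "P2 (9 - k) k" using second.per[of "1 - k" k] N by simp
      then show False using second.anti[OF _ that, of "9 - k" k] k by simp
    qed
    then show ?thesis using second.ends_cases[of 1 r "wt N"] N r by force
  qed
  moreover have 2: "?p 3 = 0 \<or> P2 3 6" if "P2 2 6"
  proof -
    have "k = 6" if "P2 3 k" for k
      using second.anti[OF that \<open>P2 2 6\<close>] six[OF that] by force
    then show ?thesis using second.begins_cases[of 3 "wt N"] by blast
  qed
  moreover have "?p 2 = 0 \<or> P2 2 6" if "P2 1 6"
  proof -
    have "k = 6" if "P2 2 k" for k
      using second.anti[OF that \<open>P2 1 6\<close>] six[OF that] by force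
    then show ?thesis using second.begins_cases[of 2 "wt N"] by blast
  qed
  moreover have 4: "?q 1 = 0 \<or> P2 3 6" if "P2 4 6"
  proof -
    have "P2 (-4) 6" using second.per[of "-4" 6] that N by simp
    have "k = 6" if "P2 (1 - k) k" for k
      using second.anti[OF that \<open>P2 (-4) 6\<close>] six[OF that] by force
    moreover have "P2 (-5) 6 = P2 3 6" using second.per[of "-5" 6] N by simp
    ultimately show ?thesis using second.ends_cases[of 1 r "wt N"] by force
  qed
  moreover have "?q 2 = 0 \<or> P2 4 6" if "P2 5 6"
  proof -
    have "P2 (-3) 6" using second.per[of "-3" 6] that N by simp
    have "k = 6" if "P2 (2 - k) k" for k
      using second.anti[OF that \<open>P2 (-3) 6\<close>] six[OF that] by force
    moreover have "P2 (-4) 6 = P2 4 6" using second.per[of "-4" 6] N by simp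
    ultimately show ?thesis using second.ends_cases[of 2 r "wt N"] by force
  qed
  ultimately have "?q 1 = 0 \<or> ?p 3 = 0 \<or> ?p 2 = 0 \<or> ?q 2 = 0" by blast
  then have "?g 1 \<le> 3/2 \<or> ?g 2 \<le> 3/2 \<or> ?g 3 \<le> 3/2" using gap by blast
  moreover have "{1..<r} = {1,2,3}" using r by auto
  moreover have "tot N ?f ?Q = (\<Sum>j\<in>{1..<r}. begins N ?f ?Q j + ends N r ?f ?Q j)"
    by (rule slots[OF circ_length]) (use r in auto)
  ultimately have "tot N (wt N) P2 + tot N ?f ?Q = 5/4 + (?g 1 + ?g 2 + ?g 3)"
      and "?g 1 \<le> 3/2 \<or> ?g 2 \<le> 3/2 \<or> ?g 3 \<le> 3/2"
    using tot_P2 r w by simp_all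
  moreover have "?g 1 \<le> 5/2" "?g 2 \<le> 5/2" "?g 3 \<le> 5/2" using gap by blast+
  ultimately show ?thesis by linarith
qed

text \<open>For \<open>N = 6\<close> the bound \<open>tot6\<close> already uses the extra unit. For
  \<open>N = 7\<close> and \<open>N = 8\<close> the unit pays 1/6 and 1/2, respectively, for each
  middle arc of length 3, of which there are at most two.\<close>

lemma tot_small:
  assumes "6 \<le> N" "N \<le> 8"
  shows "tot N (wt N) P2 + tot N (cost N) B \<le> of_int N + (if \<exists>s. B s 3 then 1 else 0)"
proof -
  let ?three = "\<lambda>k::int. if k = 3 then 1 else 0 :: real"
  have three: "tot N ?three B \<le> 2 * (if \<exists>s. B s 3 then 1 else 0)"
  proof (cases "\<exists>s. B s 3")
    case False
    then show ?thesis by (subst tot_none) auto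
  qed (use three_arcs assms in simp)
  have split: "tot N (cost N) B \<le> tot N f B + c * tot N ?three B"
    if "\<And>s k. B s k \<Longrightarrow> cost N k \<le> f k + c * ?three k" for f c
    using tot_mono[of B "cost N" "\<lambda>k. f k + c * ?three k" N, OF that] by (simp add: tot_add tot_scale)
  consider "N = 6" | "N = 7" | "N = 8" using assms by linarith
  then show ?thesis
  proof cases
    case 1
    show ?thesis
    proof (cases "\<exists>s. B s 3")
      case True
      have "cost N k \<le> 1" if "B s k" for s k
        using B_rng[OF that] 1 by (simp add: cost_def share_def wt_def)
      then have "tot N (cost N) B \<le> tot N (\<lambda>_. 1) B" by (rule tot_mono)
      then show ?thesis using tot6[OF 1] True 1 by simp
    next
      case False
      have "\<not> B s k" for s k using B_rng[of s k] 1 False by force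
      then show ?thesis using second.tot_le False by (subst tot_none) auto
    qed
  next
    case 2
    have "tot N (cost N) B \<le> tot N (\<lambda>k. if k = 3 then 2/3 else 1/2) B + 1/6 * tot N ?three B"
      by (rule split) (use 2 in \<open>auto simp: cost_def share_def wt_def\<close>)
    then show ?thesis using tot7[OF 2] three 2 by (auto split: if_splits)
  next
    case 3
    have "tot N (cost N) B \<le> tot N (\<lambda>k. if k = 5 then 1/4 else 0) B + 1/2 * tot N ?three B"
      by (rule split) (use 3 in \<open>auto simp: cost_def share_def wt_def\<close>)
    moreover have "tot N (\<lambda>k. if k = 5 then 1/4 else 0) B = tot N (\<lambda>_. 1/4) (\<lambda>s k. B s k \<and> k = 5)"
      unfolding tot_def by (intro sum.cong refl) auto
    moreover have "r = 3 \<or> r = 4" using P2_three[OF sm.base] sm.small 3 by auto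
    ultimately show ?thesis using tot8_three[OF 3] tot8_four[OF 3] three 3 by (auto split: if_splits)
  qed
qed

end

section \<open>The cycle inequality for butterfly-free families\<close>

context butterfly_cycle begin

text \<open>The unit \<open>?e\<close> moves between the antichains: a middle arc of length 3 puts a
  pair into \<open>P1\<close>, so \<open>P1\<close> stays below \<open>N\<close> by 1, and
  \<open>P2\<close> together with the costs may exceed \<open>N\<close> by 1.\<close>

theorem tot_cycle: "tot N (wt N) P1 + tot N (wt N) P2 + tot N (cost N) B \<le> 2 * of_int N"
proof (cases "6 \<le> N \<and> N \<le> 8")
  case False
  then have "tot N (cost N) B = 0" by (intro tot_none) (auto simp: cost_def share_def)
  then show ?thesis using first.tot_le second.tot_le by simp
next
  case N: True
  let ?three = "\<lambda>k::int. if k = 3 then 1 else 0 :: real"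
  let ?e = "if \<exists>s. B s 3 then 1 else 0 :: real"
  have P1: "tot N (wt N) P1 \<le> of_int N - ?e"
  proof (cases "\<exists>s. B s 3")
    case True
    then show ?thesis using three_below first.tot_le_pair N by fastforce
  next
    case False
    then show ?thesis using first.tot_le by simp
  qed
  have "tot N (wt N) P2 + tot N (cost N) B \<le> of_int N + ?e"
  proof (cases rule: second.small_or_large)
    case large
    have cost: "cost N k \<le> 1/2 + 1/2 * ?three k" if "B s k" for s k
    proof -
      have "N = 6 \<or> N = 7 \<or> N = 8" using N by linarith
      then show ?thesis using B_rng[OF that] by (auto simp: cost_def share_def wt_def)
    qed
    have "tot N (cost N) B \<le> tot N (\<lambda>_. 1/2) B + 1/2 * tot N ?three B"
      using tot_mono[of B "cost N" "\<lambda>k. 1/2 + 1/2 * ?three k" N, OF cost]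
      by (simp only: tot_add tot_scale)
    moreover have "1/2 * tot N ?three B \<le> ?e"
    proof (cases "\<exists>s. B s 3")
      case False
      then show ?thesis by (subst tot_none) auto
    qed (use three_arcs N in simp)
    moreover have "tot N (wt N) P2 + tot N (\<lambda>_. 1/2) B \<le> of_int N"
      by (rule large_bound) (rule large)
    ultimately show ?thesis by linarith
  next
    case (small c r)
    interpret S: butterfly_small N "\<lambda>s. X (s + c)" "\<lambda>s. P1 (s + c)" "\<lambda>s. P2 (s + c)" "\<lambda>s. B (s + c)" r
      by (intro butterfly_small.intro shift small)
    have "(\<exists>s. B (s + c) 3) = (\<exists>s. B s 3)" by (metis diff_add_cancel)
    then show ?thesis
      using S.tot_small N tot_shift[of P2 N "wt N" c, OF second.per] tot_shift[of B N "cost N" c, OF mid.per]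
      by simp
  qed
  then show ?thesis using P1 by linarith
qed

end

section \<open>Counting cyclic orders\<close>

lemma ex_permutes_chain:
  assumes S: "finite S" and 1: "A \<subseteq> B" "B \<subseteq> C" "C \<subseteq> S" and 2: "A' \<subseteq> B'" "B' \<subseteq> C'" "C' \<subseteq> S"
    and card: "card A = card A'" "card B = card B'" "card C = card C'"
  obtains p where "p permutes S" "p ` A = A'" "p ` B = B'" "p ` C = C'"
proof -
  have fin: "finite A" "finite B" "finite C" "finite A'" "finite B'" "finite C'"
    using S 1 2 by (meson finite_subset)+
  have "card (B - A) = card (B' - A')" "card (C - B) = card (C' - B')" "card (S - C) = card (S - C')"
    using card 1 2 fin S by (simp_all add: card_Diff_subset)
  then obtain f1 f2 f3 f4 where f: "bij_betw f1 A A'" "bij_betw f2 (B - A) (B' - A')"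
     "bij_betw f3 (C - B) (C' - B')" "bij_betw f4 (S - C) (S - C')"
    using card(1) fin S finite_same_card_bij by (metis finite_Diff)
  define f where "f x = (if x \<in> A then f1 x else if x \<in> B then f2 x else if x \<in> C then f3 x
    else if x \<in> S then f4 x else x)" for x
  have "bij_betw f A A'" using f(1) by (rule bij_betw_cong[THEN iffD1, rotated]) (simp add: f_def)
  moreover have "bij_betw f (B - A) (B' - A')"
    using f(2) by (rule bij_betw_cong[THEN iffD1, rotated]) (simp add: f_def)
  ultimately have B: "bij_betw f A A'" "bij_betw f B B'"
    using bij_betw_combine[of f A A' "B - A" "B' - A'"] 1 2 by (auto simp: Un_absorb1)
  have "bij_betw f (C - B) (C' - B')"
    using f(3) by (rule bij_betw_cong[THEN iffD1, rotated]) (use 1 in \<open>auto simp: f_def\<close>)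
  then have C: "bij_betw f C C'"
    using bij_betw_combine[of f B B' "C - B" "C' - B'"] B 1 2 by (auto simp: Un_absorb1)
  have "bij_betw f (S - C) (S - C')"
    using f(4) by (rule bij_betw_cong[THEN iffD1, rotated]) (use 1 in \<open>auto simp: f_def\<close>)
  then have "bij_betw f S S"
    using bij_betw_combine[of f C C' "S - C" "S - C'"] C 1 2 by (auto simp: Un_absorb1)
  moreover have "f x = x" if "x \<notin> S" for x using that 1 by (auto simp: f_def)
  ultimately have "f permutes S" by (rule bij_imp_permutes)
  then show ?thesis using that B C by (simp add: bij_betw_def)
qed

lemma card_supersets:
  assumes "finite S" "B \<subseteq> S" "card B \<le> c"
  shows "card {C. B \<subseteq> C \<and> C \<subseteq> S \<and> card C = c} = (card S - card B) choose (c - card B)"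
proof -
  have fB: "finite B" using assms finite_subset by blast
  have "bij_betw (\<lambda>D. B \<union> D) {D. D \<subseteq> S - B \<and> card D = c - card B} {C. B \<subseteq> C \<and> C \<subseteq> S \<and> card C = c}"
  proof (rule bij_betw_byWitness[where f' = "\<lambda>C. C - B"])
    show "(\<lambda>D. B \<union> D) ` {D. D \<subseteq> S - B \<and> card D = c - card B} \<subseteq> {C. B \<subseteq> C \<and> C \<subseteq> S \<and> card C = c}"
    proof clarify
      fix D assume D: "D \<subseteq> S - B" "card D = c - card B"
      then have "card (B \<union> D) = card B + card D"
        using assms fB by (intro card_Un_disjoint) (auto intro: finite_subset)
      then show "B \<subseteq> B \<union> D \<and> B \<union> D \<subseteq> S \<and> card (B \<union> D) = c" using D assms by auto
    qed
  qed (use fB in \<open>auto simp: card_Diff_subset\<close>)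
  then show ?thesis
    using bij_betw_same_card n_subsets[of "S - B" "c - card B"] assms fB by (fastforce simp: card_Diff_subset)
qed

text \<open>By transitivity of the symmetric group every target chain is hit equally often.\<close>

lemma card_permutes_chain:
  assumes S: "finite S" and 1: "Y \<subseteq> X" "X \<subseteq> Z" "Z \<subseteq> S" and 2: "A \<subseteq> B" "B \<subseteq> C" "C \<subseteq> S"
    and card: "card Y = card A" "card X = card B" "card Z = card C"
  shows "card {p. p permutes S \<and> p ` Y = A \<and> p ` X = B \<and> p ` Z = C}
    * ((card S choose card B) * (card B choose card A) * ((card S - card B) choose (card C - card B))) = fact (card S)"
proof -
  let ?K = "\<lambda>(B, A, C). {p. p permutes S \<and> p ` Y = A \<and> p ` X = B \<and> p ` Z = C}"
  define Bs where "Bs = {B'. B' \<subseteq> S \<and> card B' = card B}"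
  \<comment> \<open>Choosing the middle set first makes the choices of the inner and the outer set
    independent, so \<open>card T\<close> is a product.\<close>
  define T where "T = Sigma Bs (\<lambda>B'. {A'. A' \<subseteq> B' \<and> card A' = card A} \<times> {C'. B' \<subseteq> C' \<and> C' \<subseteq> S \<and> card C' = card C})"
  have finB: "finite B'" if "B' \<in> Bs" for B' using that S finite_subset by (auto simp: Bs_def)
  have le: "card B \<le> card C" using 2 S by (meson card_mono finite_subset)
  have finBs: "finite Bs" unfolding Bs_def using S by simp
  have finT: "finite T" unfolding T_def
    using finBs finB S by (intro finite_SigmaI finite_cartesian_product) auto
  have "card T = (\<Sum>B'\<in>Bs. (card B choose card A) * ((card S - card B) choose (card C - card B)))"
    unfolding T_def using finBs
  proof (subst card_SigmaI)
    show "\<forall>a\<in>Bs. finite ({A'. A' \<subseteq> a \<and> card A' = card A} \<times> {C'. a \<subseteq> C' \<and> C' \<subseteq> S \<and> card C' = card C})"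
      using finB S by auto
    show "(\<Sum>a\<in>Bs. card ({A'. A' \<subseteq> a \<and> card A' = card A} \<times> {C'. a \<subseteq> C' \<and> C' \<subseteq> S \<and> card C' = card C})) =
      (\<Sum>B'\<in>Bs. (card B choose card A) * ((card S - card B) choose (card C - card B)))"
    proof (rule sum.cong[OF refl])
      fix B' assume B': "B' \<in> Bs"
      then show "card ({A'. A' \<subseteq> B' \<and> card A' = card A} \<times> {C'. B' \<subseteq> C' \<and> C' \<subseteq> S \<and> card C' = card C}) =
         (card B choose card A) * ((card S - card B) choose (card C - card B))"
        using n_subsets[OF finB[OF B']] card_supersets[OF S, of B' "card C"] le by (simp add: card_cartesian_product Bs_def)
    qed
  qed simp
  also have "\<dots> = (card S choose card B) * ((card B choose card A) * ((card S - card B) choose (card C - card B)))"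
    using n_subsets[OF S, of "card B"] by (simp add: Bs_def)
  finally have cardT: "card T = (card S choose card B) * ((card B choose card A) * ((card S - card B) choose (card C - card B)))" .
  have finK: "finite (?K t)" for t by (rule finite_subset[OF _ finite_permutations[OF S]]) auto
  have le: "card (?K t) \<le> card (?K u)" if "t \<in> T" "u \<in> T" for t u
  proof -
    obtain B1 A1 C1 B2 A2 C2 where tu: "t = (B1, A1, C1)" "u = (B2, A2, C2)" by (cases t, cases u) auto
    have "A1 \<subseteq> B1" "B1 \<subseteq> C1" "C1 \<subseteq> S" "A2 \<subseteq> B2" "B2 \<subseteq> C2" "C2 \<subseteq> S"
      "card A1 = card A2" "card B1 = card B2" "card C1 = card C2"
      using that unfolding tu T_def Bs_def by simp_all
    then obtain q where q: "q permutes S" "q ` A1 = A2" "q ` B1 = B2" "q ` C1 = C2"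
      by (rule ex_permutes_chain[OF S])
    have "inj_on ((\<circ>) q) (?K t)"
      using fun.inj_map[OF permutes_inj[OF q(1)]] by (rule inj_on_subset) simp
    moreover have "(\<circ>) q ` ?K t \<subseteq> ?K u"
    proof (rule image_subsetI)
      fix p assume "p \<in> ?K t"
      then have p: "p permutes S" "p ` Y = A1" "p ` X = B1" "p ` Z = C1" by (simp_all add: tu)
      have "(q \<circ> p) ` V = q ` (p ` V)" for V by (simp only: image_comp)
      then show "q \<circ> p \<in> ?K u"
        unfolding tu prod.case mem_Collect_eq using permutes_compose[OF p(1) q(1)] p q by metis
    qed
    ultimately show ?thesis by (rule card_inj_on_le[OF _ _ finK])
  qed
  have t0: "(B, A, C) \<in> T" unfolding T_def Bs_def using 2 by auto
  have "{p. p permutes S} = (\<Union>t\<in>T. ?K t)"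
  proof -
    have "p \<in> ?K (p ` X, p ` Y, p ` Z) \<and> (p ` X, p ` Y, p ` Z) \<in> T" if "p permutes S" for p
    proof -
      have "card (p ` V) = card V" for V using permutes_inj[OF that] by (simp add: card_image inj_on_subset)
      moreover have "p ` Y \<subseteq> p ` X" "p ` X \<subseteq> p ` Z" "p ` X \<subseteq> S" "p ` Z \<subseteq> S"
        using 1 permutes_image[OF that] by blast+
      ultimately show ?thesis using that card by (simp add: T_def Bs_def)
    qed
    then show ?thesis by blast
  qed
  then have "fact (card S) = card (\<Union>t\<in>T. ?K t)" using card_permutations[OF refl S] by simp
  also have "\<dots> = (\<Sum>t\<in>T. card (?K t))"
    using finT finK by (intro card_UN_disjoint) (blast, blast, force)
  also have "\<dots> = (\<Sum>t\<in>T. card (?K (B, A, C)))"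
    by (intro sum.cong refl order.antisym le t0)
  finally show ?thesis using cardT by (simp add: mult.commute mult.left_commute)
qed

text \<open>Integer starts make an arc that wraps around the image of an ordinary interval; the
  residues are moved by 1 into \<open>{1..n}\<close>.\<close>

definition arc :: "nat \<Rightarrow> int \<Rightarrow> int \<Rightarrow> nat set" where
  "arc n s k = (\<lambda>i. nat (i mod int n) + 1) ` {s..<s + k}"

lemma arc_shift: "arc n (s + int n) k = arc n s k"
proof -
  have "{s + int n..<s + int n + k} = (\<lambda>i. i + int n) ` {s..<s + k}"
    by (simp add: add.commute add.left_commute)
  then have "arc n (s + int n) k = (\<lambda>i. nat (i mod int n) + 1) ` (\<lambda>i. i + int n) ` {s..<s + k}"
    by (simp only: arc_def)
  also have "\<dots> = arc n s k" unfolding arc_def image_image by simp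
  finally show ?thesis .
qed

lemma arc_mono: "t \<le> s \<Longrightarrow> s + k \<le> t + l \<Longrightarrow> arc n s k \<subseteq> arc n t l"
  unfolding arc_def by (intro image_mono) auto

lemma arc_subset: "0 < n \<Longrightarrow> arc n s k \<subseteq> {1..n}"
  unfolding arc_def by (auto simp: nat_less_iff Suc_leI)

lemma mod_eq_near:
  fixes i j :: int
  assumes "i mod N = j mod N" "\<bar>i - j\<bar> < N"
  shows "i = j"
  using assms zdvd_not_zless[of "\<bar>i - j\<bar>" N] by (auto simp: mod_eq_dvd_iff)

lemma arc_index_inj: "0 < n \<Longrightarrow> nat (i mod int n) + 1 = nat (j mod int n) + 1 \<Longrightarrow> i mod int n = j mod int n"
  by (simp add: nat_eq_iff)

lemma card_arc:
  assumes "0 < n" "k \<le> int n"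
  shows "card (arc n s k) = nat k"
proof -
  have "inj_on (\<lambda>i. nat (i mod int n) + 1) {s..<s + k}"
  proof (rule inj_onI)
    fix i j assume "i \<in> {s..<s + k}" "j \<in> {s..<s + k}" "nat (i mod int n) + 1 = nat (j mod int n) + 1"
    then show "i = j" using mod_eq_near[OF arc_index_inj[OF assms(1)], of i j] assms(2) by auto
  qed
  then show ?thesis unfolding arc_def by (simp add: card_image)
qed

lemma arc_disjoint:
  assumes "0 < n" "s + k \<le> t" "t + l \<le> s + int n"
  shows "arc n s k \<inter> arc n t l = {}"
proof -
  have False if "i \<in> {s..<s + k}" "j \<in> {t..<t + l}" "nat (i mod int n) + 1 = nat (j mod int n) + 1" for i j
    using mod_eq_near[OF arc_index_inj[OF assms(1) that(3)]] that assms by auto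
  then show ?thesis unfolding arc_def by blast
qed

text \<open>The first point of the inner arc selects the translate. If the translate reached past
  \<open>s + b\<close>, the point \<open>s + b\<close> would be congruent to one of the
  \<open>b\<close> points before it, impossible for \<open>b < n\<close>.\<close>

lemma arc_subset_arcD:
  assumes "0 < n" "0 < a" "0 \<le> b" "b < int n" "arc n t a \<subseteq> arc n s b"
  obtains j where "s \<le> t + int n * j" "t + int n * j + a \<le> s + b"
proof -
  have mem: "\<exists>i'\<in>{s..<s + b}. i' mod int n = i mod int n" if "i \<in> {t..<t + a}" for i
  proof -
    have "nat (i mod int n) + 1 \<in> arc n s b" using assms(5) that unfolding arc_def by blast
    then obtain i' where "i' \<in> {s..<s + b}" "nat (i mod int n) + 1 = nat (i' mod int n) + 1"
      unfolding arc_def by blast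
    then show ?thesis using arc_index_inj[OF assms(1), of i i'] by force
  qed
  obtain t0 where t0: "t0 \<in> {s..<s + b}" "t0 mod int n = t mod int n" using mem[of t] assms by auto
  then have "int n dvd t0 - t" by (simp add: mod_eq_dvd_iff)
  then obtain j where "t0 - t = int n * j" by (rule dvdE)
  then have j: "t0 = t + int n * j" by simp
  have "t0 + a \<le> s + b"
  proof (rule ccontr)
    assume "\<not> ?thesis"
    then have "s + b - int n * j \<in> {t..<t + a}" using t0 j by auto
    then obtain i where i: "i \<in> {s..<s + b}" "i mod int n = (s + b - int n * j) mod int n" using mem by blast
    then have "int n dvd i - (s + b - int n * j)" by (simp add: mod_eq_dvd_iff)
    then have "int n dvd (i - (s + b - int n * j)) - int n * j" by (rule dvd_diff) simp
    then have "int n dvd i - (s + b)" by (simp add: algebra_simps)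
    then have "i mod int n = (s + b) mod int n" by (simp only: mod_eq_dvd_iff)
    then show False using mod_eq_near[of i "int n" "s + b"] i assms by auto
  qed
  then show ?thesis using that t0 j by auto
qed

lemma arc_eqD:
  assumes "0 < n" "0 < a" "a < int n" "arc n t a = arc n s a" "\<bar>t - s\<bar> < int n"
  shows "t = s"
proof -
  obtain j where "s \<le> t + int n * j" "t + int n * j + a \<le> s + a"
    using arc_subset_arcD[of n a a t s] assms by auto
  then have "t + int n * j = s" by simp
  then show ?thesis using mod_eq_near[of t "int n" s] assms(5) by auto
qed

lemma finite_arc [simp]: "finite (arc n s k)"
  by (simp add: arc_def)

lemma card_arc_length:
  assumes "0 < n" "card (arc n s k) < n" "arc n s k \<noteq> {}"
  shows "int (card (arc n s k)) = k"
proof -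
  have "k < int n"
  proof (rule ccontr)
    assume "\<not> ?thesis"
    then have "card (arc n s (int n)) \<le> card (arc n s k)"
      by (intro card_mono arc_mono) auto
    then show False using card_arc[of n "int n" s] assms by simp
  qed
  moreover have "0 < k" using assms(3) by (auto simp: arc_def)
  ultimately show ?thesis using card_arc[of n k s] assms(1) by simp
qed

definition is_arc :: "nat \<Rightarrow> (nat \<Rightarrow> nat) \<Rightarrow> nat set \<Rightarrow> bool" where
  "is_arc n p F \<longleftrightarrow> (\<exists>t k. p ` arc n t k = F)"

text \<open>With \<open>B\<close> on a fixed arc, \<open>A\<close> can occupy
  \<open>b - a + 1\<close> arcs inside it and \<open>C\<close> can occupy \<open>c - b + 1\<close>
  arcs around it. These cases are disjoint and equally frequent by
  \<open>card_permutes_chain\<close>; the product form expresses independence.\<close>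

lemma card_arc_permutations:
  assumes n: "0 < n" and A: "A \<noteq> {}" "A \<subseteq> B" "B \<subseteq> C" "C \<subseteq> {1..n}" and C: "card C < n"
  shows "card {p. p permutes {1..n} \<and> p ` arc n s (int (card B)) = B \<and> is_arc n p A \<and> is_arc n p C}
      * ((n choose card B) * (card B choose card A) * ((n - card B) choose (card C - card B)))
    = (card B - card A + 1) * (card C - card B + 1) * fact n"
proof -
  define a b c where abc: "a = int (card A)" "b = int (card B)" "c = int (card C)"
  have "finite C" using A(4) finite_subset by blast
  moreover from this have "finite B" using A(3) finite_subset by blast
  moreover from this have "finite A" using A(2) finite_subset by blast
  ultimately have fin: "finite A" "finite B" "finite C" by blast+
  have le: "0 < a" "a \<le> b" "b \<le> c" "c < int n"
    unfolding abc using A C fin by (auto simp: card_gt_0_iff intro: card_mono)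
  define D where "D = (\<lambda>(t, u). {p. p permutes {1..n} \<and> p ` arc n t a = A \<and> p ` arc n s b = B \<and> p ` arc n u c = C})"
  let ?I = "{s..s + b - a} \<times> {s + b - c..s}"
  let ?K = "(n choose card B) * (card B choose card A) * ((n - card B) choose (card C - card B))"
  have card_D: "card (D x) * ?K = fact n" if x_in: "x \<in> ?I" for x
  proof -
    obtain t u where x: "x = (t, u)" "s \<le> t" "t + a \<le> s + b" "u \<le> s" "s + b \<le> u + c" using x_in by auto
    have "card (D x) * ((card {1..n} choose card B) * (card B choose card A) * ((card {1..n} - card B) choose (card C - card B))) = fact (card {1..n})"
      unfolding D_def x prod.case
    proof (rule card_permutes_chain)
      show "arc n t a \<subseteq> arc n s b" "arc n s b \<subseteq> arc n u c" using arc_mono[of s t a b n] arc_mono[of u s b c n] x by simp_all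
      show "arc n u c \<subseteq> {1..n}" using n by (rule arc_subset)
      show "card (arc n t a) = card A" "card (arc n s b) = card B" "card (arc n u c) = card C"
        using le n card_arc[of n a t] card_arc[of n b s] card_arc[of n c u] by (simp_all add: abc)
    qed (use A in auto)
    then show ?thesis by simp
  qed
  have finD: "finite (D x)" for x
    by (rule finite_subset[OF _ finite_permutations[of "{1..n}"]]) (auto simp: D_def split: prod.splits)
  have disj: "D x \<inter> D y = {}" if "x \<in> ?I" "y \<in> ?I" "x \<noteq> y" for x y
  proof (rule ccontr)
    assume "D x \<inter> D y \<noteq> {}"
    then obtain p where p: "p \<in> D x" "p \<in> D y" by blast
    obtain t u t' u' where xy: "x = (t, u)" "y = (t', u')" by (cases x, cases y) auto
    have "p permutes {1..n}" "p ` arc n t a = p ` arc n t' a" "p ` arc n u c = p ` arc n u' c"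
      using p unfolding D_def xy by simp_all
    then have "arc n t a = arc n t' a" "arc n u c = arc n u' c"
      using inj_image_eq_iff[OF permutes_inj] by metis+
    moreover have "s \<le> t" "t + a \<le> s + b" "s \<le> t'" "t' + a \<le> s + b"
      "u \<le> s" "s + b \<le> u + c" "u' \<le> s" "s + b \<le> u' + c"
      using that unfolding xy by auto
    then have "\<bar>t - t'\<bar> < int n" "\<bar>u - u'\<bar> < int n" using le by linarith+
    ultimately have "t = t'" "u = u'" using arc_eqD[of n a t t'] arc_eqD[of n c u u'] n le by simp_all
    then show False using that xy by simp
  qed
  have "{p. p permutes {1..n} \<and> p ` arc n s (int (card B)) = B \<and> is_arc n p A \<and> is_arc n p C} = (\<Union>x\<in>?I. D x)"
  proof (intro equalityI subsetI)
    fix p assume "p \<in> {p. p permutes {1..n} \<and> p ` arc n s (int (card B)) = B \<and> is_arc n p A \<and> is_arc n p C}"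
    then obtain t k u l where p: "p permutes {1..n}" "p ` arc n s b = B" "p ` arc n t k = A" "p ` arc n u l = C"
      unfolding is_arc_def abc by auto
    have inj: "inj p" using p(1) by (rule permutes_inj)
    have card_p: "card (p ` V) = card V" for V using inj by (simp add: card_image inj_on_subset)
    have "arc n t k \<noteq> {}" "arc n u l \<noteq> {}" using p(3,4) A(1-3) by blast+
    moreover have cards: "card (arc n t k) = card A" "card (arc n u l) = card C"
      using card_p[of "arc n t k"] card_p[of "arc n u l"] unfolding p by simp_all
    moreover have "card A < n" using le abc by linarith
    ultimately have "int (card (arc n t k)) = k" "int (card (arc n u l)) = l"
      using card_arc_length[OF n, of t k] card_arc_length[OF n, of u l] C by metis+
    then have k: "k = a" and l: "l = c" unfolding cards abc by blast+
    have sub: "arc n t a \<subseteq> arc n s b" "arc n s b \<subseteq> arc n u c"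
    proof -
      have "p ` arc n t k \<subseteq> p ` arc n s b" "p ` arc n s b \<subseteq> p ` arc n u l" using p(2-4) A(2,3) by simp_all
      then show "arc n t a \<subseteq> arc n s b" "arc n s b \<subseteq> arc n u c"
        unfolding inj_image_subset_iff[OF inj] k l .
    qed
    have pos: "0 < a" "0 \<le> b" "b < int n" "0 < b" "0 \<le> c" "c < int n" using le by linarith+
    obtain i where i: "s \<le> t + int n * i" "t + int n * i + a \<le> s + b"
      by (rule arc_subset_arcD[OF n pos(1,2,3) sub(1)])
    obtain j where j: "u \<le> s + int n * j" "s + int n * j + b \<le> u + c"
      by (rule arc_subset_arcD[OF n pos(4,5,6) sub(2)])
    have per: "arc n (v + int n * m) d = arc n v d" for v m d
      by (rule periodic_multiple) (rule arc_shift)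
    have "p \<in> D (t + int n * i, u + int n * (- j))"
      unfolding D_def prod.case per using p k l by simp
    moreover have "(t + int n * i, u + int n * (- j)) \<in> ?I" using i j by simp
    ultimately show "p \<in> (\<Union>x\<in>?I. D x)" by (rule UN_I[rotated])
  next
    fix p assume "p \<in> (\<Union>x\<in>?I. D x)"
    then obtain t u where "p \<in> D (t, u)" by auto
    then have "p permutes {1..n}" "p ` arc n t a = A" "p ` arc n s b = B" "p ` arc n u c = C"
      by (simp_all add: D_def)
    then show "p \<in> {p. p permutes {1..n} \<and> p ` arc n s (int (card B)) = B \<and> is_arc n p A \<and> is_arc n p C}"
      unfolding is_arc_def abc by blast
  qed
  moreover have "card (\<Union>x\<in>?I. D x) = (\<Sum>x\<in>?I. card (D x))"
    by (rule card_UN_disjoint) (use finD disj in blast)+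
  ultimately have "card {p. p permutes {1..n} \<and> p ` arc n s (int (card B)) = B \<and> is_arc n p A \<and> is_arc n p C} * ?K
      = (\<Sum>x\<in>?I. card (D x) * ?K)"
    by (simp only: sum_distrib_right)
  also have "\<dots> = (\<Sum>x\<in>?I. fact n)" by (rule sum.cong[OF refl card_D])
  also have "\<dots> = card ?I * fact n" by simp
  also have "card ?I = (card B - card A + 1) * (card C - card B + 1)"
    using le by (simp add: card_cartesian_product abc nat_add_distrib nat_diff_distrib)
  finally show ?thesis .
qed

section \<open>Averaging over all cyclic orders\<close>

text \<open>The left side is the probability that a given subset of \<open>b - m\<close> elements is
  an arc inside an arc of \<open>b\<close> elements. The bound follows from
  \<open>m * (b choose m) = b * ((b - 1) choose (m - 1))\<close> and
  \<open>b - 1 \<ge> m + 1\<close>, since \<open>(m + 1) choose (m - 1)\<close> equals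
  \<open>m * (m + 1) / 2\<close>.\<close>

lemma succ_div_binomial_le:
  assumes "1 \<le> m" "m + 2 \<le> b"
  shows "real (m + 1) / real (b choose m) \<le> 2 / real b"
proof -
  obtain k where m: "m = Suc k" using assms(1) by (cases m) auto
  have "(m + 1) * m = 2 * (m + 1 choose 2)" by (simp add: choose_two)
  also have "m + 1 choose 2 = m + 1 choose k"
    using binomial_symmetric[of 2 "m + 1"] m by simp
  also have "m + 1 choose k \<le> (b - 1) choose k" using assms by (intro binomial_right_mono) auto
  finally have "(m + 1) * m \<le> 2 * ((b - 1) choose k)" by simp
  then have "b * ((m + 1) * m) \<le> b * (2 * ((b - 1) choose k))" by (rule mult_le_mono2)
  also have "\<dots> = 2 * (m * (b choose m))"
    using binomial_absorption[of k "b"] m by simp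
  finally have "m * (b * (m + 1)) \<le> m * (2 * (b choose m))" by (simp only: ac_simps)
  then have "b * (m + 1) \<le> 2 * (b choose m)" using assms(1) by simp
  then have "real b * real (m + 1) \<le> 2 * real (b choose m)"
    by (metis of_nat_mono of_nat_mult of_nat_numeral)
  then show ?thesis using assms by (simp add: field_simps)
qed

lemma wt_div_binomial:
  assumes "1 \<le> k" "2 * k \<le> n"
  shows "wt (int n) (int k) / real (n choose k) = 1 / real (n choose (k - 1))"
proof -
  obtain j where k: "k = Suc j" using assms(1) by (cases k) auto
  have "(n - j) * (n choose j) = Suc j * (n choose Suc j)"
    using binomial_absorb_comp[of n j] binomial_absorption[of j n] by simp
  then have "real (n - j) * real (n choose j) = real (Suc j) * real (n choose Suc j)"
    by (metis of_nat_mult)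
  moreover have "0 < real (n choose j)" "0 < real (n choose Suc j)" using assms k by simp_all
  moreover have "wt (int n) (int k) = real (n - j) / real (Suc j)"
    using assms k by (simp add: wt_def of_nat_diff)
  ultimately show ?thesis using k by (simp add: frac_eq_eq mult.commute del: binomial_Suc_Suc)
qed

text \<open>The expression increases in each variable as long as \<open>q\<close> times the other is
  at most 1.\<close>

lemma bilinear_le:
  fixes q x y X Y :: real
  assumes "x \<le> X" "y \<le> Y" "0 \<le> x" "0 \<le> q" "q * X \<le> 1" "q * Y \<le> 1"
  shows "x + y - q * x * y \<le> X + Y - q * X * Y"
proof -
  have "q * x \<le> q * X" using assms by (intro mult_left_mono) auto
  then have "y * (1 - q * x) \<le> Y * (1 - q * x)" using assms by (intro mult_right_mono) auto
  moreover have "x * (1 - q * Y) \<le> X * (1 - q * Y)" using assms by (intro mult_right_mono) auto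
  ultimately show ?thesis by (simp add: algebra_simps)
qed

text \<open>With share 0 the claim reduces to \<open>(b - 2) * (n - b - 2) \<ge> 4\<close>.
  Otherwise the share gives equality at the largest \<open>x\<close> and \<open>y\<close>, and
  monotonicity does the rest.\<close>

lemma share_bound:
  fixes x y :: real
  assumes b: "3 \<le> b" "b + 3 \<le> n" and x: "0 \<le> x" "x \<le> 2 / real b" and y: "y \<le> 2 / real (n - b)"
  shows "x + y - share (int n) (int b) * x * y \<le> 1"
proof (cases "share (int n) (int b) = 0")
  case True
  have "2 * n \<le> b * (n - b)"
  proof (cases "9 \<le> n")
    case n: True
    obtain i j where ij: "b = 3 + i" "n - b = 3 + j" using b by (metis le_Suc_ex add_le_imp_le_diff add.commute)
    then have "n = 6 + i + j" using b by simp
    then show ?thesis using ij n by (simp add: algebra_simps)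
  next
    case n: False
    have "n = 6 \<or> n = 7 \<or> n = 8" using n b by linarith
    then have "n = 8 \<and> b = 4" using b True by (auto simp: share_def split: if_splits)
    then show ?thesis by simp
  qed
  then have "2 * real n \<le> real b * real (n - b)" by (metis of_nat_mono of_nat_mult of_nat_numeral)
  then have "2 / real b + 2 / real (n - b) \<le> 1"
    using b by (simp add: field_simps of_nat_diff)
  then show ?thesis using True x y by simp
next
  case False
  then have "n = 6 \<and> b = 3 \<or> n = 7 \<and> b = 3 \<or> n = 7 \<and> b = 4 \<or> n = 8 \<and> b = 3 \<or> n = 8 \<and> b = 5"
    by (auto simp: share_def split: if_splits)
  then have q: "0 \<le> share (int n) (int b)" "share (int n) (int b) * (2 / real b) \<le> 1"
    "share (int n) (int b) * (2 / real (n - b)) \<le> 1"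
    "2 / real b + 2 / real (n - b) - share (int n) (int b) * (2 / real b) * (2 / real (n - b)) \<le> 1"
    by (auto simp: share_def)
  show ?thesis by (rule order.trans[OF bilinear_le[OF x(2) y x(1) q(1-3)] q(4)])
qed

section \<open>Structure of a butterfly-free family\<close>

locale butterfly_family =
  fixes n :: nat and \<F> :: "nat set set"
  assumes subset: "\<F> \<subseteq> Pow {1..n}" and inter: "intersecting \<F>" and free: "butterfly_free \<F>"
    and size: "F \<in> \<F> \<Longrightarrow> 2 \<le> card F \<and> card F + 2 \<le> n" and n: "4 \<le> n"
begin

lemma fin: "F \<in> \<F> \<Longrightarrow> finite F"
  using subset by (meson PowD finite_atLeastAtMost finite_subset subsetD)

lemma card_less: "F \<in> \<F> \<Longrightarrow> G \<in> \<F> \<Longrightarrow> G \<subset> F \<Longrightarrow> card G < card F"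
  using fin psubset_card_mono by blast

definition mins where "mins = {F \<in> \<F>. \<forall>G\<in>\<F>. \<not> G \<subset> F}"
definition mids where "mids = {F \<in> \<F>. (\<exists>G\<in>\<F>. G \<subset> F) \<and> (\<exists>G\<in>\<F>. F \<subset> G)}"
text \<open>A set that is both minimal and maximal counts as minimal only, so every set here
  properly contains a member.\<close>

definition tops where "tops = {F \<in> \<F>. (\<exists>G\<in>\<F>. G \<subset> F) \<and> (\<forall>G\<in>\<F>. \<not> F \<subset> G)}"

lemma no_butterfly:
  assumes "A \<in> \<F>" "B \<in> \<F>" "C \<in> \<F>" "D \<in> \<F>" "A \<noteq> B" "C \<noteq> D"
    "A \<subset> C" "A \<subset> D" "B \<subset> C" "B \<subset> D"
  shows False
proof -
  have "distinct [A, B, C, D]" "A \<subseteq> C" "B \<subseteq> C" "A \<subseteq> D" "B \<subseteq> D" using assms by auto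
  then show False using free assms(1-4) unfolding butterfly_free_def by blast
qed

text \<open>The comparable pair of \<open>F\<close> and a member above it is the upper half of a
  butterfly, which need not be induced.\<close>

lemma low_unique:
  assumes "F \<in> mids" "A \<in> \<F>" "A' \<in> \<F>" "A \<subset> F" "A' \<subset> F" shows "A = A'"
proof (rule ccontr)
  assume "A \<noteq> A'"
  obtain C where "C \<in> \<F>" "F \<subset> C" using assms(1) by (auto simp: mids_def)
  then show False using no_butterfly[of A A' F C] assms \<open>A \<noteq> A'\<close> by (auto simp: mids_def)
qed

lemma high_unique:
  assumes "F \<in> mids" "C \<in> \<F>" "C' \<in> \<F>" "F \<subset> C" "F \<subset> C'" shows "C = C'"
proof (rule ccontr)
  assume "C \<noteq> C'"
  obtain A where "A \<in> \<F>" "A \<subset> F" using assms(1) by (auto simp: mids_def)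
  then show False using no_butterfly[of A F C C'] assms \<open>C \<noteq> C'\<close> by (auto simp: mids_def)
qed

definition low where "low F = (THE A. A \<in> \<F> \<and> A \<subset> F)"
definition high where "high F = (THE C. C \<in> \<F> \<and> F \<subset> C)"

lemma low: assumes "F \<in> mids" shows "low F \<in> \<F>" "low F \<subset> F"
proof -
  have "\<exists>!A. A \<in> \<F> \<and> A \<subset> F" using assms low_unique by (auto simp: mids_def)
  from theI'[OF this] show "low F \<in> \<F>" "low F \<subset> F" by (simp_all add: low_def)
qed

lemma high: assumes "F \<in> mids" shows "high F \<in> \<F>" "F \<subset> high F"
proof -
  have "\<exists>!A. A \<in> \<F> \<and> F \<subset> A" using assms high_unique by (auto simp: mids_def)
  from theI'[OF this] show "high F \<in> \<F>" "F \<subset> high F" by (simp_all add: high_def)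
qed

lemma low_eq: "F \<in> mids \<Longrightarrow> A \<in> \<F> \<Longrightarrow> A \<subset> F \<Longrightarrow> A = low F"
  using low low_unique by blast

lemma high_eq: "F \<in> mids \<Longrightarrow> C \<in> \<F> \<Longrightarrow> F \<subset> C \<Longrightarrow> C = high F"
  using high high_unique by blast

lemma mids_in: "F \<in> mids \<Longrightarrow> F \<in> \<F>" by (simp add: mids_def)

lemma low_min: assumes "F \<in> mids" shows "low F \<in> mins"
proof -
  have "\<not> G \<subset> low F" if "G \<in> \<F>" for G
    using low[OF assms] low_eq[OF assms that] by blast
  then show ?thesis using low[OF assms] by (simp add: mins_def)
qed

lemma high_top: assumes "F \<in> mids" shows "high F \<in> tops"
proof -
  have "\<not> high F \<subset> G" if "G \<in> \<F>" for G
    using high[OF assms] high_eq[OF assms that] by blast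
  then show ?thesis using high[OF assms] mids_in[OF assms] by (auto simp: tops_def)
qed

text \<open>Otherwise \<open>G\<close> would be the unique member above \<open>F\<close>, and that
  one is maximal.\<close>

lemma mids_antichain: assumes "F \<in> mids" "G \<in> mids" shows "\<not> F \<subset> G"
proof
  assume "F \<subset> G"
  then have "high F = G" using high_eq assms mids_in by blast
  then have "G \<in> tops" using high_top assms(1) by blast
  then show False using assms(2) by (auto simp: mids_def tops_def)
qed

lemma size_mid: assumes "F \<in> mids" shows "3 \<le> card F" "card F + 3 \<le> n"
  using card_less[OF mids_in[OF assms] low[OF assms]] card_less[OF high(1)[OF assms] mids_in[OF assms] high(2)[OF assms]]
    size[OF low(1)[OF assms]] size[OF high(1)[OF assms]] by simp_all

lemma partition: "\<F> = mins \<union> mids \<union> tops" "mins \<inter> mids = {}" "mins \<inter> tops = {}" "mids \<inter> tops = {}"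
  by (auto simp: mins_def mids_def tops_def)

section \<open>The trace of the family on one cyclic order\<close>

context
  fixes p :: "nat \<Rightarrow> nat"
  assumes p: "p permutes {1..n}"
begin

lemma inj_p: "inj p" using p by (rule permutes_inj)

lemma card_p: "card (p ` V) = card V" using inj_p by (simp add: card_image inj_on_subset)

lemma n_pos: "0 < n" using n by simp

lemma arc_card: assumes "p ` arc n s k \<in> \<F>" shows "int (card (p ` arc n s k)) = k"
proof -
  have "card (arc n s k) < n" "arc n s k \<noteq> {}"
    using size[OF assms] card_p[of "arc n s k"] by auto
  then show ?thesis using card_arc_length[OF n_pos, of s k] card_p by auto
qed

lemma arc_rng: assumes "p ` arc n s k \<in> \<F>" shows "2 \<le> k" "k \<le> int n - 2"
  using size[OF assms] arc_card[OF assms] by linarith+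

lemma arc_inj:
  assumes "p ` arc n s k \<in> \<F>" "p ` arc n t l = p ` arc n s k" "\<bar>t - s\<bar> < int n"
  shows "t = s" "l = k"
proof -
  show l: "l = k" using arc_card[of t l] arc_card[OF assms(1)] assms(1,2) by simp
  have "arc n t l = arc n s k" using assms(2) inj_image_eq_iff[OF inj_p] by blast
  then show "t = s" using arc_eqD[OF n_pos, of k t s] arc_rng[OF assms(1)] l assms(3) by auto
qed

lemma arc_cross:
  assumes "p ` arc n s k \<in> \<F>" "p ` arc n t l \<in> \<F>" "s + k \<le> t" shows "s + int n < t + l"
proof (rule ccontr)
  assume "\<not> ?thesis"
  then have "arc n s k \<inter> arc n t l = {}" using arc_disjoint[OF n_pos] assms(3) by simp
  then have "p ` arc n s k \<inter> p ` arc n t l = {}" using image_Int[OF inj_p] by blast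
  then show False using inter assms(1,2) unfolding intersecting_def by blast
qed

lemma circ_of_antichain:
  assumes "\<G> \<subseteq> \<F>" "\<And>F G. F \<in> \<G> \<Longrightarrow> G \<in> \<G> \<Longrightarrow> \<not> F \<subset> G"
  shows "circ (int n) (\<lambda>s k. p ` arc n s k \<in> \<G>)"
proof
  fix s k t l
  show "(p ` arc n (s + int n) k \<in> \<G>) = (p ` arc n s k \<in> \<G>)" by (simp only: arc_shift)
  show "p ` arc n s k \<in> \<G> \<Longrightarrow> 2 \<le> k \<and> k \<le> int n - 2" using arc_rng assms(1) by blast
  show "p ` arc n s k \<in> \<G> \<Longrightarrow> p ` arc n t l \<in> \<G> \<Longrightarrow> s + k \<le> t \<Longrightarrow> s + int n < t + l"
    using arc_cross assms(1) by blast
  assume h: "p ` arc n s k \<in> \<G>" "p ` arc n t l \<in> \<G>" "t \<le> s" "s + k \<le> t + l"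
  then have "p ` arc n s k \<subseteq> p ` arc n t l" by (intro image_mono arc_mono)
  then have eq: "p ` arc n t l = p ` arc n s k" using assms(2) h by blast
  then have "l = k" using arc_card[of s k] arc_card[of t l] h(1,2) assms(1) by force
  then show "s = t \<and> k = l" using h(3,4) by simp
qed simp

lemma arc_above:
  assumes "p ` arc n s k \<in> \<F>" "C \<in> \<F>" "p ` arc n s k \<subset> C" "is_arc n p C"
  obtains t where "p ` arc n t (int (card C)) = C" "t \<le> s" "s + k \<le> t + int (card C)"
proof -
  obtain t l where tl: "p ` arc n t l = C" using assms(4) by (auto simp: is_arc_def)
  then have l: "l = int (card C)" using arc_card[of t l] assms(2) by simp
  have "arc n s k \<subseteq> arc n t l" using assms(3) tl inj_image_subset_iff[OF inj_p] by blast
  then obtain j where "t \<le> s + int n * j" "s + int n * j + k \<le> t + l"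
    using arc_subset_arcD[OF n_pos, of k l s t] arc_rng[OF assms(1)] arc_rng[of t l] tl assms(2) by force
  moreover have "arc n (t + int n * (- j)) l = arc n t l"
    by (rule periodic_multiple) (rule arc_shift)
  ultimately show ?thesis using that[of "t + int n * (- j)"] tl l by simp
qed

lemma arc_below:
  assumes "p ` arc n s k \<in> \<F>" "A \<in> \<F>" "A \<subset> p ` arc n s k" "is_arc n p A"
  obtains t where "p ` arc n t (int (card A)) = A" "s \<le> t" "t + int (card A) \<le> s + k"
proof -
  obtain t l where tl: "p ` arc n t l = A" using assms(4) by (auto simp: is_arc_def)
  then have l: "l = int (card A)" using arc_card[of t l] assms(2) by simp
  have "arc n t l \<subseteq> arc n s k" using assms(3) tl inj_image_subset_iff[OF inj_p] by blast
  then obtain j where "s \<le> t + int n * j" "t + int n * j + l \<le> s + k"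
    using arc_subset_arcD[OF n_pos, of l k t s] arc_rng[OF assms(1)] arc_rng[of t l] tl assms(2) by force
  moreover have "arc n (t + int n * j) l = arc n t l"
    by (rule periodic_multiple) (rule arc_shift)
  ultimately show ?thesis using that[of "t + int n * j"] tl l by simp
qed

definition lower where "lower = {F \<in> mins. is_arc n p F} \<union> {F \<in> mids. \<not> is_arc n p (low F)}"
definition upper where "upper = {F \<in> tops. is_arc n p F} \<union> {F \<in> mids. \<not> is_arc n p (high F)}"
definition full where "full = {F \<in> mids. is_arc n p (low F) \<and> is_arc n p (high F)}"

lemma lower_antichain:
  assumes "F \<in> lower" "G \<in> lower" shows "\<not> F \<subset> G"
proof
  assume FG: "F \<subset> G"
  have F: "F \<in> \<F>" using assms(1) by (auto simp: lower_def mins_def mids_def)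
  then have G: "G \<in> mids" "\<not> is_arc n p (low G)" using assms(2) FG by (auto simp: lower_def mins_def)
  then have "F = low G" using low_eq F FG by blast
  then have "F \<in> mins" "\<not> is_arc n p F" using low_min G by auto
  then show False using assms(1) partition(2) by (auto simp: lower_def)
qed

lemma upper_antichain:
  assumes "F \<in> upper" "G \<in> upper" shows "\<not> F \<subset> G"
proof
  assume FG: "F \<subset> G"
  have G: "G \<in> \<F>" using assms(2) by (auto simp: upper_def tops_def mids_def)
  then have F: "F \<in> mids" "\<not> is_arc n p (high F)" using assms(1) FG by (auto simp: upper_def tops_def)
  then have "G = high F" using high_eq G FG by blast
  then have "G \<in> tops" "\<not> is_arc n p G" using high_top F by auto
  then show False using assms(2) partition(4) by (auto simp: upper_def)
qed

lemma upper_not_subset_full: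
  assumes "F \<in> full" "G \<in> upper" shows "\<not> G \<subseteq> F"
proof
  assume "G \<subseteq> F"
  have F: "F \<in> mids" "is_arc n p (high F)" using assms(1) by (simp_all add: full_def)
  consider "G \<in> tops" | "G \<in> mids" "\<not> is_arc n p (high G)" using assms(2) by (auto simp: upper_def)
  then show False
  proof cases
    case 1
    then have "G \<noteq> F" using F(1) partition(4) by blast
    then show False using 1 mids_in[OF F(1)] \<open>G \<subseteq> F\<close> by (auto simp: tops_def)
  next
    case 2
    then show False using F mids_antichain \<open>G \<subseteq> F\<close> by (metis psubsetI)
  qed
qed

lemma cycle: "butterfly_cycle (int n) (\<lambda>s k. p ` arc n s k \<in> \<F>) (\<lambda>s k. p ` arc n s k \<in> lower)
   (\<lambda>s k. p ` arc n s k \<in> upper) (\<lambda>s k. p ` arc n s k \<in> full)"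
proof (intro butterfly_cycle.intro)
  have sub: "lower \<subseteq> \<F>" "upper \<subseteq> \<F>" "full \<subseteq> mids" "mids \<subseteq> \<F>"
    by (auto simp: lower_def upper_def full_def mids_def mins_def tops_def)
  show "circ (int n) (\<lambda>s k. p ` arc n s k \<in> lower)" "circ (int n) (\<lambda>s k. p ` arc n s k \<in> upper)"
    "circ (int n) (\<lambda>s k. p ` arc n s k \<in> full)"
    using circ_of_antichain[of lower] circ_of_antichain[of upper] circ_of_antichain[of full]
      sub lower_antichain upper_antichain mids_antichain by (simp_all add: subset_iff)
  fix s k t l t' l'
  show "(p ` arc n (s + int n) k \<in> \<F>) = (p ` arc n s k \<in> \<F>)" by (simp only: arc_shift)
  show "p ` arc n s k \<in> \<F> \<Longrightarrow> p ` arc n t l \<in> \<F> \<Longrightarrow> s + k \<le> t \<Longrightarrow> s + int n < t + l"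
    by (rule arc_cross)
  show "p ` arc n s k \<in> lower \<Longrightarrow> p ` arc n s k \<in> \<F>" "p ` arc n s k \<in> upper \<Longrightarrow> p ` arc n s k \<in> \<F>"
    "p ` arc n s k \<in> full \<Longrightarrow> p ` arc n s k \<in> \<F>" using sub by blast+
  show "3 \<le> k" if "p ` arc n s k \<in> upper"
  proof -
    \<comment> \<open>Sets in \<open>upper\<close> are never minimal, so each properly contains a
      member with at least 2 elements.\<close>
    have "\<exists>G\<in>\<F>. G \<subset> p ` arc n s k" using that by (auto simp: upper_def tops_def mids_def)
    then obtain G where G: "G \<in> \<F>" "G \<subset> p ` arc n s k" by blast
    have "p ` arc n s k \<in> \<F>" using that sub by blast
    then show ?thesis using card_less[OF _ G] size[OF G(1)] arc_card[of s k] by linarith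
  qed
  show "(t = t') \<and> (l = l')" if "p ` arc n s k \<in> full" "p ` arc n t l \<in> upper" "p ` arc n t' l' \<in> upper"
    "t \<le> s" "s + k \<le> t + l" "t' \<le> s" "s + k \<le> t' + l'"
  proof -
    note mem = that(1)
    have *: "p ` arc n v m = high (p ` arc n s k)" if v: "p ` arc n v m \<in> upper" "v \<le> s" "s + k \<le> v + m" for v m
    proof -
      have "p ` arc n s k \<subseteq> p ` arc n v m" using v by (intro image_mono arc_mono)
      moreover have "p ` arc n s k \<notin> upper"
        using upper_not_subset_full[OF mem] by blast
      ultimately have "p ` arc n s k \<subset> p ` arc n v m" using v(1) by (metis psubsetI)
      moreover have "p ` arc n s k \<in> mids" "p ` arc n v m \<in> \<F>" using mem v(1) sub by blast+
      ultimately show ?thesis by (intro high_eq)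
    qed
    have "p ` arc n t l = p ` arc n t' l'" using *[OF that(2,4,5)] *[OF that(3,6,7)] by simp
    moreover have "p ` arc n t l \<in> \<F>" "p ` arc n t' l' \<in> \<F>" "p ` arc n s k \<in> \<F>"
      using subsetD[OF sub(2) that(2)] subsetD[OF sub(2) that(3)] subsetD[OF sub(4) subsetD[OF sub(3) mem]] .
    moreover from this have "\<bar>t - t'\<bar> < int n"
      using arc_rng[of s k] arc_rng[of t l] arc_rng[of t' l'] that(4-) by linarith
    ultimately show ?thesis using arc_inj[of t' l' t l] by simp
  qed
  show "(t = t') \<and> (l = l')" if "p ` arc n s k \<in> full" "p ` arc n t l \<in> \<F>" "p ` arc n t' l' \<in> \<F>"
    "s \<le> t" "t + l \<le> s + k" "l < k" "s \<le> t'" "t' + l' \<le> s + k" "l' < k"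
  proof -
    note mem = that(1)
    have F: "p ` arc n s k \<in> \<F>" using mem sub by blast
    have *: "p ` arc n v m = low (p ` arc n s k)" if v: "p ` arc n v m \<in> \<F>" "s \<le> v" "v + m \<le> s + k" "m < k" for v m
    proof -
      have "p ` arc n v m \<subseteq> p ` arc n s k" using v by (intro image_mono arc_mono)
      moreover have "p ` arc n v m \<noteq> p ` arc n s k"
        using arc_card[OF v(1)] arc_card[OF F] v(4) by force
      ultimately have "p ` arc n v m \<subset> p ` arc n s k" by (metis psubsetI)
      moreover have "p ` arc n s k \<in> mids" using mem sub by blast
      ultimately show ?thesis using v(1) by (intro low_eq)
    qed
    have "p ` arc n t l = p ` arc n t' l'" using *[OF that(2,4,5,6)] *[OF that(3,7,8,9)] by simp
    moreover have "\<bar>t - t'\<bar> < int n"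
      using arc_rng[OF F] arc_rng[OF that(2)] arc_rng[OF that(3)] that(4-) by linarith
    ultimately show ?thesis using arc_inj[of t' l' t l] that(3) by simp
  qed
  show False if "p ` arc n s k \<in> full" "p ` arc n t l \<in> upper" "s \<le> t" "t + l \<le> s + k"
  proof -
    have "p ` arc n t l \<subseteq> p ` arc n s k" using that by (intro image_mono arc_mono)
    then show False using upper_not_subset_full[OF that(1,2)] by blast
  qed
  assume "p ` arc n s k \<in> full"
  then have F: "p ` arc n s k \<in> mids" "is_arc n p (low (p ` arc n s k))" "is_arc n p (high (p ` arc n s k))"
    by (simp_all add: full_def)
  have k: "int (card (p ` arc n s k)) = k" using arc_card mids_in[OF F(1)] by blast
  show "3 \<le> k \<and> k \<le> int n - 3" using size_mid[OF F(1)] k by linarith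
  show "\<exists>t l. p ` arc n t l \<in> upper \<and> t \<le> s \<and> s + k \<le> t + l \<and> k < l"
  proof -
    obtain t where t: "p ` arc n t (int (card (high (p ` arc n s k)))) = high (p ` arc n s k)"
        "t \<le> s" "s + k \<le> t + int (card (high (p ` arc n s k)))"
      using arc_above[OF mids_in[OF F(1)] high[OF F(1)] F(3)] by blast
    moreover have "k < int (card (high (p ` arc n s k)))"
      using card_less[OF high(1)[OF F(1)] mids_in[OF F(1)] high(2)[OF F(1)]] k by linarith
    moreover have "high (p ` arc n s k) \<in> upper" using high_top[OF F(1)] F(3) by (simp add: upper_def)
    ultimately show ?thesis
      by (intro exI[of _ t] exI[of _ "int (card (high (p ` arc n s k)))"]) (simp only: simp_thms)
  qed
  show "\<exists>t l. p ` arc n t l \<in> lower \<and> s \<le> t \<and> t + l \<le> s + k \<and> l < k"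
  proof -
    obtain t where t: "p ` arc n t (int (card (low (p ` arc n s k)))) = low (p ` arc n s k)"
        "s \<le> t" "t + int (card (low (p ` arc n s k))) \<le> s + k"
      using arc_below[OF mids_in[OF F(1)] low[OF F(1)] F(2)] by blast
    moreover have "int (card (low (p ` arc n s k))) < k"
      using card_less[OF mids_in[OF F(1)] low[OF F(1)]] k by linarith
    moreover have "low (p ` arc n s k) \<in> lower" using low_min[OF F(1)] F(2) by (simp add: lower_def)
    ultimately show ?thesis
      by (intro exI[of _ t] exI[of _ "int (card (low (p ` arc n s k)))"]) (simp only: simp_thms)
  qed
qed

text \<open>How often \<open>F\<close> is counted on the cycle given by \<open>p\<close> when it is an arc there; the average over
  all \<open>p\<close> has to be at least 1.\<close>

definition credit :: "nat set \<Rightarrow> real" where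
  "credit F = (if F \<in> mids then 2 - of_bool (is_arc n p (low F)) - of_bool (is_arc n p (high F))
      + share (int n) (int (card F)) * of_bool (is_arc n p (low F) \<and> is_arc n p (high F)) else 1)"

lemma credit_eq:
  assumes "is_arc n p F"
  shows "of_bool (F \<in> lower) + of_bool (F \<in> upper) + share (int n) (int (card F)) * of_bool (F \<in> full)
    = (if F \<in> \<F> then credit F else 0)"
proof -
  consider "F \<notin> \<F>" | "F \<in> mins" | "F \<in> mids" | "F \<in> tops" using partition(1) by blast
  then show ?thesis
  proof cases
    case 1
    then have "F \<notin> mins" "F \<notin> mids" "F \<notin> tops" using partition(1) by blast+
    then show ?thesis using 1 by (simp add: lower_def upper_def full_def)
  next
    case 2
    then have "F \<in> \<F>" "F \<notin> mids" "F \<notin> tops" using partition by blast+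
    then show ?thesis using 2 assms by (simp add: lower_def upper_def full_def credit_def)
  next
    case 3
    then have "F \<in> \<F>" "F \<notin> mins" "F \<notin> tops" using partition by blast+
    then show ?thesis using 3 by (simp add: lower_def upper_def full_def credit_def)
  next
    case 4
    then have "F \<in> \<F>" "F \<notin> mids" "F \<notin> mins" using partition by blast+
    then show ?thesis using 4 assms by (simp add: lower_def upper_def full_def credit_def)
  qed
qed

lemma finite_family: "finite \<F>"
  using subset finite_subset by blast

text \<open>For a fixed start, an arc in the family and its length determine each other. This turns
  \<open>tot_cycle\<close> into a sum over members, ready to be exchanged with the sum over
  permutations.\<close>

lemma cycle_sum:
  "(\<Sum>s\<in>{0..<int n}. \<Sum>F\<in>\<F>. if p ` arc n s (int (card F)) = F then wt (int n) (int (card F)) * credit F else 0)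
     \<le> 2 * real n"
proof -
  let ?N = "int n"
  let ?h = "\<lambda>s k. if p ` arc n s k \<in> \<F> then wt ?N k * credit (p ` arc n s k) else 0"
  have point: "(if p ` arc n s k \<in> lower then wt ?N k else 0) + (if p ` arc n s k \<in> upper then wt ?N k else 0)
      + (if p ` arc n s k \<in> full then cost ?N k else 0) = ?h s k" for s k
  proof -
    let ?F = "p ` arc n s k"
    have "(if ?F \<in> full then cost ?N k else 0) = wt ?N k * (share ?N (int (card ?F)) * of_bool (?F \<in> full))"
    proof (cases "?F \<in> full")
      case True
      then have "?F \<in> \<F>" using mids_in by (simp add: full_def)
      then show ?thesis using True arc_card[of s k] by (simp add: cost_def)
    qed simp
    then have "(if ?F \<in> lower then wt ?N k else 0) + (if ?F \<in> upper then wt ?N k else 0)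
      + (if ?F \<in> full then cost ?N k else 0)
      = wt ?N k * (of_bool (?F \<in> lower) + of_bool (?F \<in> upper) + share ?N (int (card ?F)) * of_bool (?F \<in> full))"
      by (simp add: distrib_left)
    also have "\<dots> = ?h s k"
    proof -
      have "is_arc n p ?F" by (auto simp: is_arc_def)
      then show ?thesis unfolding credit_eq[OF \<open>is_arc n p ?F\<close>] by simp
    qed
    finally show ?thesis .
  qed
  have "(\<Sum>F\<in>\<F>. if p ` arc n s (int (card F)) = F then wt ?N (int (card F)) * credit F else 0)
      = (\<Sum>k\<in>{2..?N - 2}. ?h s k)" for s
  proof -
    have "(\<Sum>F\<in>\<F>. if p ` arc n s (int (card F)) = F then wt ?N (int (card F)) * credit F else 0)
       = (\<Sum>F\<in>{F \<in> \<F>. p ` arc n s (int (card F)) = F}. wt ?N (int (card F)) * credit F)"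
      using finite_family by (simp add: sum.inter_filter)
    also have "\<dots> = (\<Sum>k\<in>{k \<in> {2..?N - 2}. p ` arc n s k \<in> \<F>}. wt ?N k * credit (p ` arc n s k))"
    proof (rule sum.reindex_bij_witness[where i = "\<lambda>k. p ` arc n s k" and j = "\<lambda>F. int (card F)"])
      fix F assume "F \<in> {F \<in> \<F>. p ` arc n s (int (card F)) = F}"
      then have F: "F \<in> \<F>" "p ` arc n s (int (card F)) = F" by simp_all
      show "p ` arc n s (int (card F)) = F" by (rule F)
      show "int (card F) \<in> {k \<in> {2..?N - 2}. p ` arc n s k \<in> \<F>}"
        using size[OF F(1)] F by auto
      show "wt ?N (int (card F)) * credit (p ` arc n s (int (card F))) = wt ?N (int (card F)) * credit F"
        unfolding F(2) ..
    next
      fix k assume "k \<in> {k \<in> {2..?N - 2}. p ` arc n s k \<in> \<F>}"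
      then have k: "p ` arc n s k \<in> \<F>" by simp
      show "int (card (p ` arc n s k)) = k" by (rule arc_card[OF k])
      then show "p ` arc n s k \<in> {F \<in> \<F>. p ` arc n s (int (card F)) = F}" using k by simp
    qed
    also have "\<dots> = (\<Sum>k\<in>{2..?N - 2}. ?h s k)" by (simp only: sum.inter_filter[OF finite_atLeastAtMost_int])
    finally show ?thesis .
  qed
  then have "(\<Sum>s\<in>{0..<?N}. \<Sum>F\<in>\<F>. if p ` arc n s (int (card F)) = F then wt ?N (int (card F)) * credit F else 0)
     = tot ?N (wt ?N) (\<lambda>s k. p ` arc n s k \<in> lower) + tot ?N (wt ?N) (\<lambda>s k. p ` arc n s k \<in> upper)
       + tot ?N (cost ?N) (\<lambda>s k. p ` arc n s k \<in> full)"
    unfolding tot_def by (simp only: point[symmetric] sum.distrib)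
  also have "\<dots> \<le> 2 * real n" using butterfly_cycle.tot_cycle[OF cycle] by simp
  finally show ?thesis .
qed

end

text \<open>The two quotients are the conditional probabilities that \<open>A\<close> and
  \<open>C\<close> are arcs when \<open>F\<close> is the arc at \<open>s\<close>; for
  \<open>A = F\<close> or \<open>C = F\<close> the quotient is 1.\<close>

lemma count_through:
  assumes "F \<in> \<F>" "A \<noteq> {}" "A \<subseteq> F" "F \<subseteq> C" "C \<subseteq> {1..n}" "card C < n"
  shows "real (card {p. p permutes {1..n} \<and> p ` arc n s (int (card F)) = F \<and> is_arc n p A \<and> is_arc n p C})
    = fact n / real (n choose card F) * (real (card F - card A + 1) / real (card F choose card A))
      * (real (card C - card F + 1) / real ((n - card F) choose (card C - card F)))"
proof -
  have c: "finite C" using assms(5) finite_subset by blast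
  have le: "card A \<le> card F" "card F \<le> card C" "card C \<le> n"
    using assms c fin[OF assms(1)] by (auto intro: card_mono)
  have pos: "0 < real (n choose card F)" "0 < real (card F choose card A)" "0 < real ((n - card F) choose (card C - card F))"
    using le by simp_all
  have "real (card {p. p permutes {1..n} \<and> p ` arc n s (int (card F)) = F \<and> is_arc n p A \<and> is_arc n p C}
      * ((n choose card F) * (card F choose card A) * ((n - card F) choose (card C - card F))))
    = real ((card F - card A + 1) * (card C - card F + 1) * fact n)"
    unfolding of_nat_eq_iff by (rule card_arc_permutations) (use assms n in auto)
  then show ?thesis using pos by (simp only: of_nat_mult of_nat_fact) (simp add: field_simps)
qed

text \<open>For a middle set the mean credit is \<open>2 - x - y + q * x * y\<close>, with
  \<open>x\<close> and \<open>y\<close> the probabilities that the lower and the upper set are arcs;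
  \<open>share_bound\<close> makes it at least 1.\<close>

lemma credit_sum:
  assumes F: "F \<in> \<F>"
  shows "fact n / real (n choose card F)
    \<le> (\<Sum>p\<in>{p. p permutes {1..n} \<and> p ` arc n s (int (card F)) = F}. credit p F)"
proof -
  let ?Q = "{p. p permutes {1..n} \<and> p ` arc n s (int (card F)) = F}"
  let ?K = "fact n / real (n choose card F)"
  let ?c = "\<lambda>P. real (card {p. p permutes {1..n} \<and> p ` arc n s (int (card F)) = F \<and> P p})"
  have finQ: "finite ?Q" by (rule finite_subset[OF _ finite_permutations[of "{1..n}"]]) auto
  have F': "F \<noteq> {}" "F \<subseteq> {1..n}" "card F < n" using size[OF F] subset F by auto
  have arcF: "p ` arc n s (int (card F)) = F \<Longrightarrow> is_arc n p F" for p by (auto simp: is_arc_def)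
  have Q: "real (card ?Q) = ?K"
  proof -
    have "?Q = {p. p permutes {1..n} \<and> p ` arc n s (int (card F)) = F \<and> is_arc n p F \<and> is_arc n p F}"
      using arcF by blast
    then show ?thesis using count_through[OF F F'(1) order.refl order.refl F'(2,3)] by simp
  qed
  show ?thesis
  proof (cases "F \<in> mids")
    case False
    then have "(\<Sum>p\<in>?Q. credit p F) = real (card ?Q)" by (simp add: credit_def)
    then show ?thesis using Q by simp
  next
    case True
    let ?a = "card (low F)" and ?b = "card F" and ?d = "card (high F)"
    let ?x = "real (?b - ?a + 1) / real (?b choose ?a)"
    let ?y = "real (?d - ?b + 1) / real ((n - ?b) choose (?d - ?b))"
    let ?q = "share (int n) (int ?b)"
    have lo: "low F \<in> \<F>" "low F \<subseteq> F" "low F \<noteq> {}" and hi: "high F \<in> \<F>" "F \<subseteq> high F" "high F \<subseteq> {1..n}" "?d < n"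
      using low[OF True] high[OF True] size[of "low F"] size[of "high F"] subset by auto
    have cards: "2 \<le> ?a" "?a < ?b" "?b < ?d" "?d + 2 \<le> n"
      using card_less[OF F low[OF True]] card_less[OF high(1)[OF True] F high(2)[OF True]]
        size[OF lo(1)] size[OF hi(1)] by simp_all
    have of: "(\<Sum>p\<in>?Q. of_bool (P p)) = ?c P" for P :: "(nat \<Rightarrow> nat) \<Rightarrow> bool"
    proof -
      have "?Q \<inter> {p. P p} = {p. p permutes {1..n} \<and> p ` arc n s (int (card F)) = F \<and> P p}" by blast
      then show ?thesis using finQ by simp
    qed
    have factor: "2 * k - k * x - k * y + q * (k * x * y) = k * (2 - (x + y - q * x * y))" for k x y q :: real
      by (simp add: algebra_simps)
    have L: "?c (\<lambda>p. is_arc n p (low F)) = ?K * ?x"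
    proof -
      have "{p. p permutes {1..n} \<and> p ` arc n s (int (card F)) = F \<and> is_arc n p (low F)}
        = {p. p permutes {1..n} \<and> p ` arc n s (int (card F)) = F \<and> is_arc n p (low F) \<and> is_arc n p F}"
        using arcF by blast
      then show ?thesis using count_through[OF F lo(3,2) order.refl F'(2,3)] by simp
    qed
    have H: "?c (\<lambda>p. is_arc n p (high F)) = ?K * ?y"
    proof -
      have "{p. p permutes {1..n} \<and> p ` arc n s (int (card F)) = F \<and> is_arc n p (high F)}
        = {p. p permutes {1..n} \<and> p ` arc n s (int (card F)) = F \<and> is_arc n p F \<and> is_arc n p (high F)}"
        using arcF by blast
      then show ?thesis using count_through[OF F F'(1) order.refl hi(2-4)] by simp
    qed
    have LH: "?c (\<lambda>p. is_arc n p (low F) \<and> is_arc n p (high F)) = ?K * ?x * ?y"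
      using count_through[OF F lo(3,2) hi(2-4)] by simp
    have "(\<Sum>p\<in>?Q. credit p F) = (\<Sum>p\<in>?Q. 2 - of_bool (is_arc n p (low F)) - of_bool (is_arc n p (high F))
        + ?q * of_bool (is_arc n p (low F) \<and> is_arc n p (high F)))"
      using True by (simp add: credit_def)
    also have "\<dots> = 2 * real (card ?Q) - (\<Sum>p\<in>?Q. of_bool (is_arc n p (low F))) - (\<Sum>p\<in>?Q. of_bool (is_arc n p (high F)))
        + ?q * (\<Sum>p\<in>?Q. of_bool (is_arc n p (low F) \<and> is_arc n p (high F)))"
      by (simp only: sum.distrib sum_subtractf sum_distrib_left[symmetric] sum_constant)
    also have "\<dots> = 2 * ?K - ?K * ?x - ?K * ?y + ?q * (?K * ?x * ?y)"
      unfolding of L H LH Q ..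
    also have "\<dots> = ?K * (2 - (?x + ?y - ?q * ?x * ?y))" by (rule factor)
    also have "\<dots> \<ge> ?K * 1"
    proof (rule mult_left_mono)
      have x: "?x \<le> 2 / real ?b"
        using succ_div_binomial_le[of "?b - ?a" ?b] cards binomial_symmetric[of ?a ?b] by simp
      have y: "?y \<le> 2 / real (n - ?b)"
        using succ_div_binomial_le[of "?d - ?b" "n - ?b"] cards by simp
      show "1 \<le> 2 - (?x + ?y - ?q * ?x * ?y)"
        using share_bound[of ?b n ?x ?y] x y cards by simp
    qed simp
    finally show ?thesis by simp
  qed
qed

text \<open>Double counting over permutations, starts and members: each permutation contributes at
  most \<open>2 * n\<close>, and each member receives at least n! times its summand from every
  start.\<close>

theorem weighted_sum: "(\<Sum>F\<in>\<F>. wt (int n) (int (card F)) / real (n choose card F)) \<le> 2"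
proof -
  let ?P = "{p. p permutes {1..n}}"
  let ?w = "\<lambda>F. wt (int n) (int (card F))"
  let ?g = "\<lambda>p s F. if p ` arc n s (int (card F)) = F then ?w F * credit p F else 0"
  have finP: "finite ?P" by (rule finite_permutations) simp
  have "real n * fact n * (\<Sum>F\<in>\<F>. ?w F / real (n choose card F))
      = (\<Sum>F\<in>\<F>. \<Sum>s\<in>{0..<int n}. ?w F * (fact n / real (n choose card F)))"
    by (simp add: sum_distrib_left ac_simps)
  also have "\<dots> \<le> (\<Sum>F\<in>\<F>. \<Sum>s\<in>{0..<int n}. \<Sum>p\<in>?P. ?g p s F)"
  proof (intro sum_mono)
    fix F s assume F: "F \<in> \<F>"
    have "?w F * (fact n / real (n choose card F)) \<le> ?w F * (\<Sum>p\<in>{p. p permutes {1..n} \<and> p ` arc n s (int (card F)) = F}. credit p F)"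
      by (intro mult_left_mono credit_sum F wt_nonneg) simp
    also have "\<dots> = (\<Sum>p\<in>{p \<in> ?P. p ` arc n s (int (card F)) = F}. ?w F * credit p F)"
      by (simp add: sum_distrib_left)
    also have "\<dots> = (\<Sum>p\<in>?P. ?g p s F)" by (simp only: sum.inter_filter[OF finP])
    finally show "?w F * (fact n / real (n choose card F)) \<le> (\<Sum>p\<in>?P. ?g p s F)" .
  qed
  also have "\<dots> = (\<Sum>F\<in>\<F>. \<Sum>p\<in>?P. \<Sum>s\<in>{0..<int n}. ?g p s F)"
    by (rule sum.cong[OF refl sum.swap])
  also have "\<dots> = (\<Sum>p\<in>?P. \<Sum>F\<in>\<F>. \<Sum>s\<in>{0..<int n}. ?g p s F)" by (rule sum.swap)
  also have "\<dots> = (\<Sum>p\<in>?P. \<Sum>s\<in>{0..<int n}. \<Sum>F\<in>\<F>. ?g p s F)"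
    by (rule sum.cong[OF refl sum.swap])
  also have "\<dots> \<le> (\<Sum>p\<in>?P. 2 * real n)"
    by (rule sum_mono) (use cycle_sum in blast)
  also have "\<dots> = real n * fact n * 2" using card_permutations[of "{1..n}" n] by simp
  finally show ?thesis using n by simp
qed

end

theorem theorem10:
  fixes n :: nat and \<F> :: "nat set set"
  assumes "\<F> \<subseteq> Pow {1..n}"
    and "intersecting \<F>"
    and "butterfly_free \<F>"
    and "\<And>F. F \<in> \<F> \<Longrightarrow> 2 \<le> card F \<and> card F \<le> n - 2"
  shows "(\<Sum>F\<in>{F\<in>\<F>. real (card F) \<le> real n / 2}. 1 / real (n choose (card F - 1)))
       + (\<Sum>F\<in>{F\<in>\<F>. real (card F) > real n / 2}. 1 / real (n choose (card F))) \<le> 2"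
proof (cases "\<F> = {}")
  case True
  then show ?thesis by simp
next
  case False
  then have n: "4 \<le> n" using assms(4) by fastforce
  interpret butterfly_family n \<F>
    using assms n by unfold_locales force+
  let ?w = "\<lambda>F. wt (int n) (int (card F)) / real (n choose card F)"
  have "(\<Sum>F\<in>{F\<in>\<F>. real (card F) \<le> real n / 2}. 1 / real (n choose (card F - 1)))
      = (\<Sum>F\<in>{F\<in>\<F>. real (card F) \<le> real n / 2}. ?w F)"
  proof (rule sum.cong[OF refl])
    fix F assume "F \<in> {F\<in>\<F>. real (card F) \<le> real n / 2}"
    then have "1 \<le> card F" "2 * card F \<le> n" using size[of F] by auto
    then show "1 / real (n choose (card F - 1)) = ?w F" using wt_div_binomial by simp
  qed
  moreover have "(\<Sum>F\<in>{F\<in>\<F>. real (card F) > real n / 2}. 1 / real (n choose (card F)))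
      = (\<Sum>F\<in>{F\<in>\<F>. real (card F) > real n / 2}. ?w F)"
    by (rule sum.cong) (auto simp: wt_def)
  moreover have "(\<Sum>F\<in>{F\<in>\<F>. real (card F) \<le> real n / 2}. ?w F) + (\<Sum>F\<in>{F\<in>\<F>. real (card F) > real n / 2}. ?w F)
      = (\<Sum>F\<in>\<F>. ?w F)"
    using finite_subset[OF assms(1)] by (subst sum.union_disjoint[symmetric]) (auto intro!: sum.cong)
  ultimately show ?thesis using weighted_sum by simp
qed

end
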